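(* Let $d_1,\ldots,d_M,R\in\mathbb{N}$, $r\ge0$ and let $\omega\in[0,\infty]^{d_1\times\cdots\times d_M}$ be a weight tensor. Then $$ \mathcal{M}_{R,r,\omega}-\mathcal{M}_{R,r,\omega}\subseteq\mathcal{M}_{2R,2r,\omega}, $$ where the left-hand side is the set of all differences $A-B$ with $A,B\in\mathcal{M}_{R,r,\omega}$.
   Context: $[M]=\{1,\ldots,M\}$. Contraction of tensors: $(A\circ B)_{i_1,\ldots,i_{m-1},i_{m+1},\ldots,i_N}:=\sum_{i_m}A_{i_1,\ldots,i_m}B_{i_m,\ldots,i_N}$. Vectorisation is row-major. For $T\in\mathbb{R}^{e_1\times\cdots\times e_N}$, $\operatorname{unfold}_k(T)$ is the $(e_1\cdots e_k)\times(e_{k+1}\cdots e_N)$ matrix with the same vectorisation; $T$ is left-orthogonal if $\operatorname{unfold}_{N-1}(T)^\intercal\operatorname{unfold}_{N-1}(T)=I$ and right-orthogonal if $\operatorname{unfold}_1(T)\operatorname{unfold}_1(T)^\intercal=I$. A tensor is $m$-sparse if it has $m$ non-zero entries. $\|C\|_{\ell^0_\beta}:=\sum_{j:\,C_j\ne0}\beta_j^2$. For $k\in[M]$, $\mathcal{Q}_{R,k}$ is the set of all $$ Q=\operatorname{unfold}_k\big(U^{(1)}\circ\cdots\circ U^{(k-1)}\big)\otimes I_{d_k}\otimes\operatorname{unfold}_1\big(V^{(k+1)}\circ\cdots\circ V^{(M)}\big)^\intercal $$ ($\otimes$ the Kronecker product of matrices, empty contractions equal to the scalar $1$), where $U^{(j)},V^{(j)}\in\{0,1\}^{r_{j-1}\times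 d_j\times r_j}$ with $r_{j-1},r_j\le R$, $r_0=r_M=1$, all $U^{(j)}$ are left-orthogonal and $r_j$-sparse, and all $V^{(j)}$ are right-orthogonal and $r_{j-1}$-sparse. (The leading mode of size $r_0=1$ is counted in $\operatorname{unfold}_k$, so the first factor has size $(d_1\cdots d_{k-1})\times r_{k-1}$.) $Q$ is regarded as a linear operator $\mathbb{R}^{r_{k-1}\times d_k\times r_k}\to\mathbb{R}^{d_1\times\cdots\times d_M}$. Set $\mathcal{C}_{Q,r,\omega}:=\{C\in\mathbb{R}^{r_{k-1}\times d_k\times r_k}:\|C\|_{\ell^0_{Q^\intercal\omega}}\le r\}$ and $$ \mathcal{M}_{R,r,\omega}:=\bigcap_{k\in[M]}\ \bigcup_{Q\in\mathcal{Q}_{R,k}}Q\,\mathcal{C}_{Q,r,\omega}. $$ *)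

theory Defs
  imports "Jordan_Normal_Form.Matrix" "HOL-Library.Extended_Nonnegative_Real"
begin

text \<open>A tensor of shape \<open>[e\<^sub>1, \<dots>, e\<^sub>N]\<close> is a function on lists that vanishes outside the (0-based)
  multi-indices of that shape, so that equality and subtraction of tensors of a given shape are
  equality and pointwise subtraction of functions. The shape is not recorded in the function and
  is passed explicitly where it is needed.\<close>

definition multi_indices :: "nat list \<Rightarrow> nat list set" where
  "multi_indices es = {is. length is = length es \<and> (\<forall>m < length es. is ! m < es ! m)}"

definition tensors :: "nat list \<Rightarrow> (nat list \<Rightarrow> 'a::zero) set" where
  "tensors es = {T. \<forall>is. is \<notin> multi_indices es \<longrightarrow> T is = 0}"

text \<open>The multi-index at a given position in the row-major (last index fastest) ordering.\<close>

fun multi_index_at :: "nat list \<Rightarrow> nat \<Rightarrow> nat list" where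
  "multi_index_at [] a = []"
| "multi_index_at (e # es) a = (a div prod_list es) # multi_index_at es (a mod prod_list es)"

lemma bij_betw_multi_index_at:
  "bij_betw (multi_index_at es) {..<prod_list es} (multi_indices es)"
proof (induction es)
  case Nil
  then show ?case by (auto simp: bij_betw_def inj_on_def multi_indices_def)
next
  case (Cons e es)
  let ?p = "prod_list es"
  have inj: "inj_on (multi_index_at (e # es)) {..<prod_list (e # es)}"
  proof (rule inj_onI)
    fix a b
    assume a: "a \<in> {..<prod_list (e # es)}"
      and eq: "multi_index_at (e # es) a = multi_index_at (e # es) b"
    from a have "?p > 0" by (cases "?p = 0") auto
    then have "a mod ?p \<in> {..<?p}" "b mod ?p \<in> {..<?p}" by auto
    with eq Cons.IH have "a mod ?p = b mod ?p"
      by (auto simp: bij_betw_def inj_on_def)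
    with eq show "a = b" by (metis div_mult_mod_eq list.inject multi_index_at.simps(2))
  qed
  have "multi_index_at (e # es) ` {..<prod_list (e # es)} = multi_indices (e # es)"
  proof (intro equalityI subsetI)
    fix js assume "js \<in> multi_index_at (e # es) ` {..<prod_list (e # es)}"
    then obtain a where a: "a < e * ?p" and js: "js = multi_index_at (e # es) a" by auto
    from a have "?p > 0" by (cases "?p = 0") auto
    then have "multi_index_at es (a mod ?p) \<in> multi_indices es"
      using Cons.IH by (auto simp: bij_betw_def)
    moreover have "a div ?p < e" using a by (simp add: less_mult_imp_div_less)
    ultimately show "js \<in> multi_indices (e # es)"
      using js by (auto simp: multi_indices_def nth_Cons split: nat.splits)
  next
    fix js assume "js \<in> multi_indices (e # es)"
    then obtain j ks where js: "js = j # ks" "j < e" and ks: "ks \<in> multi_indices es"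
      by (cases js) (fastforce simp: multi_indices_def)+
    from ks Cons.IH obtain b where b: "b < ?p" "ks = multi_index_at es b"
      by (auto simp: bij_betw_def)
    have "j * ?p + b < Suc j * ?p" using b by simp
    also have "\<dots> \<le> e * ?p" using js by (intro mult_le_mono1) simp
    finally show "js \<in> multi_index_at (e # es) ` {..<prod_list (e # es)}"
      using js b by (intro image_eqI[of _ _ "j * ?p + b"]) auto
  qed
  with inj show ?case unfolding bij_betw_def by blast
qed

definition vectorise :: "nat list \<Rightarrow> (nat list \<Rightarrow> 'a) \<Rightarrow> 'a vec" where
  "vectorise es T = vec (prod_list es) (\<lambda>a. T (multi_index_at es a))"

definition unfold :: "nat list \<Rightarrow> nat \<Rightarrow> (nat list \<Rightarrow> 'a) \<Rightarrow> 'a mat" where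
  "unfold es k T = mat (prod_list (take k es)) (prod_list (drop k es))
     (\<lambda>(a, b). vectorise es T $ (a * prod_list (drop k es) + b))"

definition left_orthogonal :: "nat list \<Rightarrow> (nat list \<Rightarrow> real) \<Rightarrow> bool" where
  "left_orthogonal es T \<longleftrightarrow>
     (let A = unfold es (length es - 1) T in transpose_mat A * A = 1\<^sub>m (dim_col A))"

definition right_orthogonal :: "nat list \<Rightarrow> (nat list \<Rightarrow> real) \<Rightarrow> bool" where
  "right_orthogonal es T \<longleftrightarrow>
     (let A = unfold es 1 T in A * transpose_mat A = 1\<^sub>m (dim_row A))"

definition sparse :: "nat list \<Rightarrow> nat \<Rightarrow> (nat list \<Rightarrow> real) \<Rightarrow> bool" where
  "sparse es m T \<longleftrightarrow> card {is \<in> multi_indices es. T is \<noteq> 0} = m"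

text \<open>\<open>contract m e A B\<close> is the contraction \<open>A \<circ> B\<close> of the last mode of the order-\<open>m\<close> tensor \<open>A\<close>
  with the first mode of \<open>B\<close>, both of size \<open>e\<close>.\<close>

definition contract ::
  "nat \<Rightarrow> nat \<Rightarrow> (nat list \<Rightarrow> real) \<Rightarrow> (nat list \<Rightarrow> real) \<Rightarrow> nat list \<Rightarrow> real" where
  "contract m e A B = (\<lambda>is. \<Sum>l<e. A (take (m - 1) is @ [l]) * B (l # drop (m - 1) is))"

text \<open>\<open>contract_cores \<rho> X a n\<close> is \<open>X\<^sup>(\<^sup>a\<^sup>) \<circ> \<dots> \<circ> X\<^sup>(\<^sup>a\<^sup>+\<^sup>n\<^sup>-\<^sup>1\<^sup>)\<close> for order-3 cores \<open>X\<^sup>(\<^sup>j\<^sup>)\<close> of shape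
  \<open>[\<rho> (j - 1), d j, \<rho> j]\<close>, and \<open>cores_shape\<close> is its shape. A contraction of \<open>n + 1\<close> cores has order
  \<open>n + 3\<close>. The empty contraction is the scalar 1, a tensor of order 0, all of whose unfoldings are
  the 1-by-1 matrix with entry 1.\<close>

fun contract_cores ::
  "(nat \<Rightarrow> nat) \<Rightarrow> (nat \<Rightarrow> nat list \<Rightarrow> real) \<Rightarrow> nat \<Rightarrow> nat \<Rightarrow> nat list \<Rightarrow> real" where
  "contract_cores \<rho> X a 0 = (\<lambda>is. if is = [] then 1 else 0)"
| "contract_cores \<rho> X a (Suc 0) = X a"
| "contract_cores \<rho> X a (Suc (Suc n)) =
     contract (n + 3) (\<rho> (a + n)) (contract_cores \<rho> X a (Suc n)) (X (a + Suc n))"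

definition cores_shape :: "(nat \<Rightarrow> nat) \<Rightarrow> (nat \<Rightarrow> nat) \<Rightarrow> nat \<Rightarrow> nat \<Rightarrow> nat list" where
  "cores_shape \<rho> d a n =
     (if n = 0 then [] else \<rho> (a - 1) # map d [a..<a + n] @ [\<rho> (a + n - 1)])"

definition kronecker :: "'a::times mat \<Rightarrow> 'a mat \<Rightarrow> 'a mat" where
  "kronecker A B = mat (dim_row A * dim_row B) (dim_col A * dim_col B)
     (\<lambda>(i, j). A $$ (i div dim_row B, j div dim_col B) * B $$ (i mod dim_row B, j mod dim_col B))"

text \<open>The family \<open>\<Q>\<^bsub>R,k\<^esub>\<close>. Each matrix is paired with the shape \<open>[r\<^bsub>k-1\<^esub>, d\<^sub>k, r\<^sub>k]\<close> of the tensors it acts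
  on, since its number of columns does not determine that shape.\<close>

definition sparse_ops :: "nat \<Rightarrow> (nat \<Rightarrow> nat) \<Rightarrow> nat \<Rightarrow> nat \<Rightarrow> (nat list \<times> real mat) set" where
  "sparse_ops M d R k =
     {(es, Q). \<exists>\<rho> U V.
        \<rho> 0 = 1 \<and> \<rho> M = 1 \<and>
        (\<forall>j\<in>{1..<k}. let s = [\<rho> (j - 1), d j, \<rho> j] in
           \<rho> (j - 1) \<le> R \<and> \<rho> j \<le> R \<and> U j \<in> tensors s \<and> range (U j) \<subseteq> {0, 1} \<and>
           left_orthogonal s (U j) \<and> sparse s (\<rho> j) (U j)) \<and>
        (\<forall>j\<in>{k<..M}. let s = [\<rho> (j - 1), d j, \<rho> j] in
           \<rho> (j - 1) \<le> R \<and> \<rho> j \<le> R \<and> V j \<in> tensors s \<and> range (V j) \<subseteq> {0, 1} \<and>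
           right_orthogonal s (V j) \<and> sparse s (\<rho> (j - 1)) (V j)) \<and>
        es = [\<rho> (k - 1), d k, \<rho> k] \<and>
        Q = kronecker
              (kronecker
                (unfold (cores_shape \<rho> d 1 (k - 1)) k (contract_cores \<rho> U 1 (k - 1)))
                (1\<^sub>m (d k)))
              (transpose_mat
                (unfold (cores_shape \<rho> d (k + 1) (M - k)) 1
                  (contract_cores \<rho> V (k + 1) (M - k))))}"

definition l0_norm :: "ennreal vec \<Rightarrow> real vec \<Rightarrow> ennreal" where
  "l0_norm \<beta> c = (\<Sum>j\<in>{j. j < dim_vec c \<and> c $ j \<noteq> 0}. (\<beta> $ j)\<^sup>2)"

text \<open>The core sets \<open>C\<^bsub>Q,r,\<omega>\<^esub>\<close>. The weights \<open>Q\<^sup>T \<omega>\<close> are formed with \<open>0 \<cdot> \<infinity> = 0\<close>; the matrices in question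
  have entries in \<open>{0, 1}\<close>, so the coercion to \<^typ>\<open>ennreal\<close> is exact.\<close>

definition weighted_cores ::
  "nat list \<Rightarrow> nat list \<Rightarrow> real mat \<Rightarrow> real \<Rightarrow> (nat list \<Rightarrow> ennreal) \<Rightarrow> (nat list \<Rightarrow> real) set" where
  "weighted_cores ds es Q r \<omega> =
     {C \<in> tensors es.
        l0_norm (map_mat ennreal (transpose_mat Q) *\<^sub>v vectorise ds \<omega>) (vectorise es C) \<le> ennreal r}"

text \<open>The image of a set of tensors of shape \<open>es\<close> under the matrix \<open>Q\<close>, regarded as a linear operator
  into the tensors of shape \<open>ds\<close>.\<close>

definition operator_image ::
  "nat list \<Rightarrow> nat list \<Rightarrow> real mat \<Rightarrow> (nat list \<Rightarrow> real) set \<Rightarrow> (nat list \<Rightarrow> real) set" where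
  "operator_image ds es Q \<C> =
     {A \<in> tensors ds. \<exists>C\<in>\<C>. vectorise ds A = Q *\<^sub>v vectorise es C}"

definition sparse_model ::
  "nat \<Rightarrow> (nat \<Rightarrow> nat) \<Rightarrow> nat \<Rightarrow> real \<Rightarrow> (nat list \<Rightarrow> ennreal) \<Rightarrow> (nat list \<Rightarrow> real) set" where
  "sparse_model M d R r \<omega> =
     (let ds = map d [1..<M + 1] in
      \<Inter>k\<in>{1..M}. \<Union>(es, Q)\<in>sparse_ops M d R k. operator_image ds es Q (weighted_cores ds es Q r \<omega>))"

end

theory Submission
  imports Defs
begin

text \<open>Membership in the model depends only on the support of a tensor, through cardinalities and a sum of
  weights that are subadditive under unions of supports. The reason is that orthogonal and sparse
  \<open>0/1\<close> cores are purely combinatorial objects. A left-orthogonal core \<open>U\<close> of shape \<open>[a, d, b]\<close> picks, for each last index \<open>l\<close>,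
  exactly one pair \<open>(p, i)\<close>, and different \<open>l\<close> get different pairs
  (\<open>left_orthogonal_iff\<close>). Following these choices through
  \<open>U\<^sup>(\<^sup>1\<^sup>) \<circ> \<dots> \<circ> U\<^sup>(\<^sup>j\<^sup>)\<close> labels the \<open>r\<^sub>j\<close> values of the last index by distinct multi-indices of length
  \<open>j\<close>, each of which extends a label of length \<open>j - 1\<close> by one entry. Right-orthogonal cores similarly
  label indices by suffixes. Hence every \<open>Q\<close> in \<open>\<Q>\<^bsub>R,k\<^esub>\<close> is a matrix whose columns are distinct unit
  vectors (\<open>core_matrix_selection\<close>): it places the core \<open>C\<close> at the positions obtained by joining a
  prefix label, a value of the \<open>k\<close>-th index and a suffix label. In particular the weighted
  \<open>\<ell>\<^sup>0\<close>-norm of \<open>C\<close> is the sum of \<open>\<omega>\<^sup>2\<close> over the support of \<open>Q C\<close>, whatever \<open>Q\<close> is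
  (\<open>operator_image_selection_iff\<close>).

  Conversely, the sets of prefixes, respectively suffixes, of the elements of any support are
  themselves nested label sets, and their enumerations define cores of the required kind
  (\<open>codes_sparse_ops\<close>). This gives a description of the model without any matrices
  (\<open>sparse_model_iff\<close>): a tensor \<open>A\<close> belongs to it iff \<open>\<omega>\<^sup>2\<close> sums to at most \<open>r\<close> over the support of
  \<open>A\<close>, and for every \<open>0 < j < M\<close> at most \<open>R\<close> different prefixes of length \<open>j\<close> and at most \<open>R\<close>
  different suffixes starting at \<open>j\<close> occur in the support (and \<open>R \<ge> 1\<close> if \<open>M > 1\<close>, because the
  boundary ranks are \<open>1\<close>). The support of \<open>A - B\<close> lies in the union of the supports of \<open>A\<close> and \<open>B\<close>,
  and all these quantities are subadditive under unions.\<close>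

section \<open>Row-major enumeration of multi-indices\<close>

lemma multi_indices_Nil: "multi_indices [] = {[]}"
  by (auto simp: multi_indices_def)

lemma multi_indices_Cons: "multi_indices (e # es) = {i # is | i is. i < e \<and> is \<in> multi_indices es}"
proof (intro equalityI subsetI)
  fix js assume "js \<in> multi_indices (e # es)"
  then show "js \<in> {i # is | i is. i < e \<and> is \<in> multi_indices es}"
    by (cases js) (fastforce simp: multi_indices_def)+
next
  fix js assume "js \<in> {i # is | i is. i < e \<and> is \<in> multi_indices es}"
  then show "js \<in> multi_indices (e # es)"
    by (auto simp: multi_indices_def nth_Cons split: nat.splits)
qed

lemma multi_indices_append:
  "multi_indices (es @ fs) = {is @ js | is js. is \<in> multi_indices es \<and> js \<in> multi_indices fs}"
proof (induction es)
  case (Cons e es)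
  show ?case
    unfolding append_Cons multi_indices_Cons Cons
    by (auto simp: append_eq_Cons_conv; (metis append_Cons | blast))
qed (simp add: multi_indices_Nil)

lemma snoc_in_multi_indices_iff:
  "is @ [i] \<in> multi_indices (es @ [e]) \<longleftrightarrow> is \<in> multi_indices es \<and> i < e"
  by (auto simp: multi_indices_append multi_indices_Cons multi_indices_Nil)

lemma multi_indices_snocE:
  assumes "is \<in> multi_indices (es @ [e])"
  obtains js i where "is = js @ [i]" "js \<in> multi_indices es" "i < e"
  using assms by (auto simp: multi_indices_append multi_indices_Cons multi_indices_Nil)

lemma length_multi_indices: "is \<in> multi_indices es \<Longrightarrow> length is = length es"
  by (simp add: multi_indices_def)

lemma finite_multi_indices: "finite (multi_indices es)"
  using bij_betw_finite[OF bij_betw_multi_index_at[of es]] by simp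

lemma multi_index_at_in: "a < prod_list es \<Longrightarrow> multi_index_at es a \<in> multi_indices es"
  using bij_betw_multi_index_at[of es] by (auto simp: bij_betw_def)

lemma sum_multi_index_at:
  "(\<Sum>a<prod_list es. f (multi_index_at es a)) = (\<Sum>is\<in>multi_indices es. f is)"
  using sum.reindex_bij_betw[OF bij_betw_multi_index_at[of es], of f] by simp

text \<open>Row-major enumeration treats a pair of multi-indices like the two digits of a number in base
  \<open>prod_list fs\<close>. Unfoldings and Kronecker products split positions by the same division, so their
  entries can be read in terms of multi-indices instead of positions.\<close>

lemma multi_index_at_append:
  assumes "a < prod_list (es @ fs)"
  shows "multi_index_at (es @ fs) a =
    multi_index_at es (a div prod_list fs) @ multi_index_at fs (a mod prod_list fs)"
  using assms
proof (induction es arbitrary: a)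
  case (Cons e es)
  let ?q = "prod_list es" and ?p = "prod_list fs"
  have pos: "?p > 0" "?q > 0"
    using Cons.prems by (auto intro: gr0I)
  have eq: "a mod (?q * ?p) = ?p * (a div ?p mod ?q) + a mod ?p"
    by (metis mod_mult2_eq mult.commute)
  have "a mod (?q * ?p) < ?q * ?p"
    using pos by simp
  moreover have "a mod (?q * ?p) div ?p = a div ?p mod ?q"
    using pos by (simp add: eq)
  moreover have "a mod (?q * ?p) mod ?p = a mod ?p"
    by (simp add: eq)
  moreover have "a div (?q * ?p) = a div ?p div ?q"
    by (metis div_mult2_eq mult.commute)
  ultimately show ?case
    using Cons.IH[of "a mod (?q * ?p)"] by simp
qed simp

lemma unfold_carrier:
  "unfold (es @ fs) (length es) T \<in> carrier_mat (prod_list es) (prod_list fs)"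
  by (simp add: unfold_def)

lemma unfold_entry:
  assumes "p < prod_list es" "q < prod_list fs"
  shows "unfold (es @ fs) (length es) T $$ (p, q) = T (multi_index_at es p @ multi_index_at fs q)"
proof -
  have "p * prod_list fs + q < Suc p * prod_list fs" using assms by simp
  also have "\<dots> \<le> prod_list es * prod_list fs" using assms by (intro mult_le_mono1) simp
  finally have "p * prod_list fs + q < prod_list (es @ fs)" by simp
  with assms show ?thesis
    by (simp add: unfold_def vectorise_def multi_index_at_append)
qed

section \<open>Orthogonal zero-one cores are selections\<close>

text \<open>The function \<open>h\<close> stands for the entries of an order-3 core. For a left-orthogonal core \<open>X\<close> it is
  \<open>h p i l = X [p, i, l]\<close>; for a right-orthogonal one the outer two modes are exchanged, so that both
  kinds of cores are covered by the same combinatorics.\<close>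

definition slice_selection :: "nat \<Rightarrow> nat \<Rightarrow> nat \<Rightarrow> (nat \<Rightarrow> nat \<Rightarrow> nat \<Rightarrow> real) \<Rightarrow> (nat \<Rightarrow> nat \<times> nat) \<Rightarrow> bool" where
  "slice_selection a d b h g \<longleftrightarrow> inj_on g {..<b} \<and> g ` {..<b} \<subseteq> {..<a} \<times> {..<d} \<and>
     (\<forall>p<a. \<forall>i<d. \<forall>l<b. h p i l = of_bool (g l = (p, i)))"

text \<open>For \<open>0/1\<close> vectors, norm \<open>1\<close> means having a single one, and being orthogonal means that these ones
  are at different places.\<close>

lemma zero_one_orthonormal_iff:
  fixes h :: "'k \<Rightarrow> nat \<Rightarrow> real"
  assumes "finite K" and zo: "\<And>x l. h x l \<in> {0, 1}"
  shows "(\<forall>l<b. \<forall>l'<b. (\<Sum>x\<in>K. h x l * h x l') = of_bool (l = l')) \<longleftrightarrow>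
    (\<exists>g. inj_on g {..<b} \<and> g ` {..<b} \<subseteq> K \<and> (\<forall>x\<in>K. \<forall>l<b. h x l = of_bool (g l = x)))"
    (is "?L \<longleftrightarrow> ?R")
proof
  assume L: ?L
  have h01: "h x l \<noteq> 0 \<longleftrightarrow> h x l = 1" for x l using zo[of x l] by auto
  have "\<exists>y\<in>K. \<forall>x\<in>K. h x l = of_bool (y = x)" if "l < b" for l
  proof -
    have "real (card {x\<in>K. h x l = 1}) = (\<Sum>x\<in>K. of_bool (h x l = 1))"
      using \<open>finite K\<close> by (simp add: of_bool_def sum.If_cases Int_def)
    also have "\<dots> = (\<Sum>x\<in>K. h x l * h x l)"
      using h01 by (intro sum.cong) (auto simp: of_bool_def)
    also have "\<dots> = 1" using L that by simp
    finally have "card {x\<in>K. h x l = 1} = 1" by simp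
    then obtain y where "{x\<in>K. h x l = 1} = {y}" by (auto simp: card_1_singleton_iff)
    then have "y \<in> K" "\<And>x. x \<in> K \<Longrightarrow> h x l = 1 \<longleftrightarrow> y = x" by auto
    with h01 show ?thesis by (intro bexI[of _ y]) (auto simp: of_bool_def)
  qed
  then obtain g where g: "\<And>l. l < b \<Longrightarrow> g l \<in> K"
    "\<And>l x. l < b \<Longrightarrow> x \<in> K \<Longrightarrow> h x l = of_bool (g l = x)" by metis
  have "inj_on g {..<b}"
  proof (rule inj_onI, rule ccontr)
    fix l l' assume l: "l \<in> {..<b}" "l' \<in> {..<b}" "g l = g l'" "l \<noteq> l'"
    have "(\<Sum>x\<in>K. h x l * h x l') = (\<Sum>x\<in>K. if g l = x then 1 else 0)"
      using l g by (intro sum.cong) auto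
    also have "\<dots> = 1" using l g \<open>finite K\<close> by simp
    finally show False using L l by auto
  qed
  with g show ?R by blast
next
  assume ?R
  then obtain g where g: "inj_on g {..<b}" "g ` {..<b} \<subseteq> K"
    "\<forall>x\<in>K. \<forall>l<b. h x l = of_bool (g l = x)" by blast
  show ?L
  proof (intro allI impI)
    fix l l' assume l: "l < b" "l' < b"
    have "(\<Sum>x\<in>K. h x l * h x l') = (\<Sum>x\<in>K. if g l = x then of_bool (l = l') else 0)"
      using l g by (intro sum.cong) (auto simp: inj_on_def)
    also have "\<dots> = of_bool (l = l')" using l g \<open>finite K\<close> by (auto simp: sum.delta)
    finally show "(\<Sum>x\<in>K. h x l * h x l') = of_bool (l = l')" .
  qed
qed

lemma sum_multi_indices_2:
  "(\<Sum>y\<in>multi_indices [a, b]. f y) = (\<Sum>(p, i)\<in>{..<a} \<times> {..<b}. f [p, i])"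
  by (intro sum.reindex_bij_witness[of _ "\<lambda>(p, i). [p, i]" "\<lambda>y. (y ! 0, y ! 1)"])
    (auto simp: multi_indices_Cons multi_indices_Nil)

text \<open>The Gram matrix in the definition of orthogonality is a sum over row positions of the unfolding;
  rewritten as a sum over pairs \<open>(p, i)\<close>, it has the form treated by \<open>zero_one_orthonormal_iff\<close>.\<close>

lemma left_orthogonal_iff:
  assumes "range X \<subseteq> {0, 1}"
  shows "left_orthogonal [a, d, b] X \<longleftrightarrow> (\<exists>g. slice_selection a d b (\<lambda>p i l. X [p, i, l]) g)"
proof -
  define A where "A = unfold [a, d, b] 2 X"
  have A: "A \<in> carrier_mat (a * d) b"
    using unfold_carrier[of "[a, d]" "[b]" X] by (simp add: A_def numeral_2_eq_2)
  have ent: "A $$ (r, l) = X (multi_index_at [a, d] r @ [l])" if "r < a * d" "l < b" for r l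
    using unfold_entry[of r "[a, d]" l "[b]" X] that by (simp add: A_def numeral_2_eq_2)
  have gram: "(transpose_mat A * A) $$ (l, l') = (\<Sum>x\<in>{..<a} \<times> {..<d}. X [fst x, snd x, l] * X [fst x, snd x, l'])"
    if "l < b" "l' < b" for l l'
  proof -
    have "(transpose_mat A * A) $$ (l, l') = (\<Sum>r<prod_list [a, d]. A $$ (r, l) * A $$ (r, l'))"
      using A that by (auto simp: scalar_prod_def atLeast0LessThan intro!: sum.cong)
    also have "\<dots> = (\<Sum>r<prod_list [a, d]. X (multi_index_at [a, d] r @ [l]) * X (multi_index_at [a, d] r @ [l']))"
      using that by (intro sum.cong) (auto simp: ent)
    also have "\<dots> = (\<Sum>y\<in>multi_indices [a, d]. X (y @ [l]) * X (y @ [l']))"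
      by (rule sum_multi_index_at)
    finally show ?thesis by (simp add: sum_multi_indices_2 case_prod_beta)
  qed
  have "left_orthogonal [a, d, b] X \<longleftrightarrow> transpose_mat A * A = 1\<^sub>m b"
    using A by (simp add: left_orthogonal_def A_def Let_def numeral_2_eq_2)
  also have "\<dots> \<longleftrightarrow> (\<forall>l<b. \<forall>l'<b. (transpose_mat A * A) $$ (l, l') = of_bool (l = l'))"
    using A by (auto simp: mat_eq_iff of_bool_def simp del: index_mult_mat(1))
  also have "\<dots> \<longleftrightarrow> (\<forall>l<b. \<forall>l'<b. (\<Sum>x\<in>{..<a} \<times> {..<d}. X [fst x, snd x, l] * X [fst x, snd x, l']) = of_bool (l = l'))"
    using gram by simp
  also have "\<dots> \<longleftrightarrow> (\<exists>g. slice_selection a d b (\<lambda>p i l. X [p, i, l]) g)"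
    using assms
    by (subst zero_one_orthonormal_iff)
      (auto simp: slice_selection_def Ball_def image_subset_iff intro!: arg_cong[where f = Ex] ext)
  finally show ?thesis .
qed

lemma right_orthogonal_iff:
  assumes "range X \<subseteq> {0, 1}"
  shows "right_orthogonal [a, d, b] X \<longleftrightarrow> (\<exists>g. slice_selection b d a (\<lambda>l i p. X [p, i, l]) g)"
proof -
  define A where "A = unfold [a, d, b] 1 X"
  have A: "A \<in> carrier_mat a (d * b)"
    using unfold_carrier[of "[a]" "[d, b]" X] by (simp add: A_def)
  have ent: "A $$ (p, r) = X (p # multi_index_at [d, b] r)" if "r < d * b" "p < a" for r p
    using unfold_entry[of p "[a]" r "[d, b]" X] that by (simp add: A_def)
  have gram: "(A * transpose_mat A) $$ (p, p') = (\<Sum>x\<in>{..<b} \<times> {..<d}. X [p, snd x, fst x] * X [p', snd x, fst x])"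
    if "p < a" "p' < a" for p p'
  proof -
    have "(A * transpose_mat A) $$ (p, p') = (\<Sum>r<prod_list [d, b]. A $$ (p, r) * A $$ (p', r))"
      using A that by (auto simp: scalar_prod_def atLeast0LessThan intro!: sum.cong)
    also have "\<dots> = (\<Sum>r<prod_list [d, b]. X (p # multi_index_at [d, b] r) * X (p' # multi_index_at [d, b] r))"
      using that by (intro sum.cong) (auto simp: ent)
    also have "\<dots> = (\<Sum>y\<in>multi_indices [d, b]. X (p # y) * X (p' # y))"
      by (rule sum_multi_index_at)
    also have "\<dots> = (\<Sum>x\<in>{..<b} \<times> {..<d}. X [p, snd x, fst x] * X [p', snd x, fst x])"
      unfolding sum_multi_indices_2
      by (intro sum.reindex_bij_witness[of _ prod.swap prod.swap]) auto
    finally show ?thesis .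
  qed
  have "right_orthogonal [a, d, b] X \<longleftrightarrow> A * transpose_mat A = 1\<^sub>m a"
    using A by (simp add: right_orthogonal_def A_def Let_def)
  also have "\<dots> \<longleftrightarrow> (\<forall>p<a. \<forall>p'<a. (A * transpose_mat A) $$ (p, p') = of_bool (p = p'))"
    using A by (auto simp: mat_eq_iff of_bool_def simp del: index_mult_mat(1))
  also have "\<dots> \<longleftrightarrow> (\<forall>p<a. \<forall>p'<a. (\<Sum>x\<in>{..<b} \<times> {..<d}. X [p, snd x, fst x] * X [p', snd x, fst x]) = of_bool (p = p'))"
    using gram by simp
  also have "\<dots> \<longleftrightarrow> (\<exists>g. slice_selection b d a (\<lambda>l i p. X [p, i, l]) g)"
    using assms
    by (subst zero_one_orthonormal_iff)
      (auto simp: slice_selection_def Ball_def image_subset_iff intro!: arg_cong[where f = Ex] ext)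
  finally show ?thesis .
qed

text \<open>Each \<open>l\<close> selects exactly one nonzero entry. This supplies the sparsity of the cores built from labels
  below.\<close>

lemma card_slice_selection:
  assumes "slice_selection a d b h g"
  shows "card {(p, i, l). p < a \<and> i < d \<and> l < b \<and> h p i l \<noteq> 0} = b"
proof -
  have "bij_betw (\<lambda>l. (fst (g l), snd (g l), l)) {..<b} {(p, i, l). p < a \<and> i < d \<and> l < b \<and> h p i l \<noteq> 0}"
    using assms
    by (intro bij_betw_byWitness[where f' = "\<lambda>(p, i, l). l"])
      (auto simp: slice_selection_def image_subset_iff mem_Times_iff split: if_splits)
  from bij_betw_same_card[OF this] show ?thesis by simp
qed

lemma sparse_left:
  assumes "slice_selection a d b (\<lambda>p i l. X [p, i, l]) g"
  shows "sparse [a, d, b] b X"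
proof -
  have "bij_betw (\<lambda>(p, i, l). [p, i, l]) {(p, i, l). p < a \<and> i < d \<and> l < b \<and> X [p, i, l] \<noteq> 0}
    {is \<in> multi_indices [a, d, b]. X is \<noteq> 0}"
    by (intro bij_betw_byWitness[where f' = "\<lambda>y. (y ! 0, y ! 1, y ! 2)"])
      (auto simp: multi_indices_Cons multi_indices_Nil)
  from bij_betw_same_card[OF this] show ?thesis
    using card_slice_selection[OF assms] by (simp add: sparse_def)
qed

lemma sparse_right:
  assumes "slice_selection b d a (\<lambda>l i p. X [p, i, l]) g"
  shows "sparse [a, d, b] a X"
proof -
  have "bij_betw (\<lambda>(l, i, p). [p, i, l]) {(l, i, p). l < b \<and> i < d \<and> p < a \<and> X [p, i, l] \<noteq> 0}
    {is \<in> multi_indices [a, d, b]. X is \<noteq> 0}"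
    by (intro bij_betw_byWitness[where f' = "\<lambda>y. (y ! 2, y ! 1, y ! 0)"])
      (auto simp: multi_indices_Cons multi_indices_Nil)
  from bij_betw_same_card[OF this] show ?thesis
    using card_slice_selection[OF assms] by (simp add: sparse_def)
qed

section \<open>Labelling rank indices by prefixes and suffixes\<close>

text \<open>The label of the rank index \<open>l < \<rho> j\<close> is the multi-index \<open>e j l\<close> of length \<open>j\<close>. The labels form a
  tree in which \<open>e (Suc j) l\<close> is a child of some \<open>e j p\<close>; a node may have no children.\<close>

definition nested_code :: "(nat \<Rightarrow> nat) \<Rightarrow> (nat \<Rightarrow> nat) \<Rightarrow> nat \<Rightarrow> (nat \<Rightarrow> nat \<Rightarrow> nat list) \<Rightarrow> bool" where
  "nested_code \<rho> d n e \<longleftrightarrow> \<rho> 0 = 1 \<and> e 0 0 = [] \<and> (\<forall>j\<le>n. inj_on (e j) {..<\<rho> j}) \<and>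
     (\<forall>j<n. \<forall>l<\<rho> (Suc j). \<exists>p<\<rho> j. \<exists>i<d (Suc j). e (Suc j) l = e j p @ [i])"

text \<open>The choice \<open>(p, i)\<close> made by a core for \<open>l\<close> becomes the recursion \<open>e (Suc j) l = e j p @ [i]\<close>. The
  labels stay distinct because distinct \<open>l\<close> have distinct choices.\<close>

lemma nested_code_of_selections:
  assumes "\<rho> 0 = 1"
    and "\<And>j. j < n \<Longrightarrow> \<exists>g. slice_selection (\<rho> j) (d (Suc j)) (\<rho> (Suc j)) (h (Suc j)) g"
  obtains e where "nested_code \<rho> d n e"
    and "\<And>j p i l. j < n \<Longrightarrow> p < \<rho> j \<Longrightarrow> i < d (Suc j) \<Longrightarrow> l < \<rho> (Suc j) \<Longrightarrow>
      h (Suc j) p i l = of_bool (e (Suc j) l = e j p @ [i])"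
proof -
  have "\<forall>j\<in>{..<n}. \<exists>g. slice_selection (\<rho> j) (d (Suc j)) (\<rho> (Suc j)) (h (Suc j)) g"
    using assms(2) by simp
  from bchoice[OF this] obtain g
    where g: "\<And>j. j < n \<Longrightarrow> slice_selection (\<rho> j) (d (Suc j)) (\<rho> (Suc j)) (h (Suc j)) (g j)"
    by auto
  define e where "e = rec_nat (\<lambda>l. []) (\<lambda>j f l. f (fst (g j l)) @ [snd (g j l)])"
  have e0: "e 0 l = []" and eS: "e (Suc j) l = e j (fst (g j l)) @ [snd (g j l)]" for j l
    by (simp_all add: e_def)
  have gr: "fst (g j l) < \<rho> j" "snd (g j l) < d (Suc j)" if "j < n" "l < \<rho> (Suc j)" for j l
    using g[OF that(1)] that(2) by (auto simp: slice_selection_def image_subset_iff mem_Times_iff)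
  have inj: "inj_on (e j) {..<\<rho> j}" if "j \<le> n" for j
    using that
  proof (induction j)
    case 0
    then show ?case using assms by (auto simp: inj_on_def)
  next
    case (Suc j)
    show ?case
    proof (rule inj_onI)
      fix l l' assume l: "l \<in> {..<\<rho> (Suc j)}" "l' \<in> {..<\<rho> (Suc j)}" "e (Suc j) l = e (Suc j) l'"
      then have "g j l = g j l'"
        using Suc gr[of j l] gr[of j l'] by (auto simp: eS inj_on_def prod_eq_iff)
      then show "l = l'" using g[of j] Suc l by (auto simp: slice_selection_def inj_on_def)
    qed
  qed
  show thesis
  proof
    show "nested_code \<rho> d n e"
      unfolding nested_code_def using assms(1) inj e0 eS gr by metis
    fix j p i l assume a: "j < n" "p < \<rho> j" "i < d (Suc j)" "l < \<rho> (Suc j)"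
    have "g j l = (p, i) \<longleftrightarrow> e (Suc j) l = e j p @ [i]"
      using a gr[of j l] inj[of j] by (auto simp: eS inj_on_def prod_eq_iff)
    then show "h (Suc j) p i l = of_bool (e (Suc j) l = e j p @ [i])"
      using g[of j] a by (simp add: slice_selection_def)
  qed
qed

lemma selection_of_nested_code:
  assumes "nested_code \<rho> d n e" "j < n"
  shows "\<exists>g. slice_selection (\<rho> j) (d (Suc j)) (\<rho> (Suc j))
    (\<lambda>p i l. of_bool (e (Suc j) l = e j p @ [i])) g"
proof -
  have inj: "inj_on (e j) {..<\<rho> j}" "inj_on (e (Suc j)) {..<\<rho> (Suc j)}"
    using assms by (auto simp: nested_code_def)
  obtain p i where pi: "\<And>l. l < \<rho> (Suc j) \<Longrightarrow> p l < \<rho> j \<and> i l < d (Suc j) \<and> e (Suc j) l = e j (p l) @ [i l]"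
    using assms unfolding nested_code_def by metis
  have "slice_selection (\<rho> j) (d (Suc j)) (\<rho> (Suc j))
    (\<lambda>p i l. of_bool (e (Suc j) l = e j p @ [i])) (\<lambda>l. (p l, i l))"
    unfolding slice_selection_def
  proof (intro conjI allI impI)
    show "inj_on (\<lambda>l. (p l, i l)) {..<\<rho> (Suc j)}"
      using pi inj by (auto simp: inj_on_def)
  qed (use pi inj in \<open>auto simp: inj_on_def\<close>)
  then show ?thesis by blast
qed

text \<open>Enumerating each of the nested finite sets labels the rank indices, with the cardinalities as ranks.\<close>

lemma nested_code_of_sets:
  assumes "S 0 = {[]}" and fin: "\<And>j. j \<le> n \<Longrightarrow> finite (S j)"
    and "\<And>j x. j < n \<Longrightarrow> x \<in> S (Suc j) \<Longrightarrow> \<exists>y\<in>S j. \<exists>i<d (Suc j). x = y @ [i]"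
  obtains e where "nested_code (\<lambda>j. card (S j)) d n e"
    and "\<And>j. j \<le> n \<Longrightarrow> e j ` {..<card (S j)} = S j"
proof -
  have "\<exists>f. bij_betw f {..<card (S j)} (S j)" if "j \<le> n" for j
    using ex_bij_betw_nat_finite[OF fin[OF that]] by (simp add: atLeast0LessThan)
  then obtain e where e: "\<And>j. j \<le> n \<Longrightarrow> bij_betw (e j) {..<card (S j)} (S j)" by metis
  then have im: "e j ` {..<card (S j)} = S j" if "j \<le> n" for j
    using that by (simp add: bij_betw_def)
  show thesis
  proof
    show "nested_code (\<lambda>j. card (S j)) d n e"
      unfolding nested_code_def
    proof (intro conjI allI impI)
      show "card (S 0) = 1" by (simp add: assms)
      show "e 0 0 = []" using im[of 0] assms(1) by auto
      fix j assume "j \<le> n"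
      then show "inj_on (e j) {..<card (S j)}" using e by (simp add: bij_betw_def)
    next
      fix j l assume j: "j < n" and "l < card (S (Suc j))"
      then have "e (Suc j) l \<in> S (Suc j)" using im[of "Suc j"] by auto
      then obtain y i where y: "y \<in> S j" "i < d (Suc j)" "e (Suc j) l = y @ [i]"
        using assms(3) j by blast
      moreover obtain p where "p < card (S j)" "y = e j p"
        using y(1) im[of j] j by auto
      ultimately show "\<exists>p<card (S j). \<exists>i<d (Suc j). e (Suc j) l = e j p @ [i]" by blast
    qed
  qed (fact im)
qed

lemma nested_code_in:
  assumes "nested_code \<rho> d n e" "j \<le> n" "l < \<rho> j"
  shows "e j l \<in> multi_indices (map d [1..<Suc j])"
  using assms(2,3)
proof (induction j arbitrary: l)
  case 0
  then show ?case using assms by (simp add: nested_code_def multi_indices_Nil)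
next
  case (Suc j)
  then obtain p i where "p < \<rho> j" "i < d (Suc j)" "e (Suc j) l = e j p @ [i]"
    using assms(1) unfolding nested_code_def by (metis Suc_le_eq)
  with Suc show ?case
    using snoc_in_multi_indices_iff[of "e j p" i "map d [1..<Suc j]" "d (Suc j)"] by simp
qed

lemma nested_code_take:
  assumes "nested_code \<rho> d n e" "j \<le> m" "m \<le> n" "l < \<rho> m"
  shows "take j (e m l) \<in> e j ` {..<\<rho> j}"
  using assms(2,3,4)
proof (induction m arbitrary: l)
  case 0
  then show ?case by (auto simp: take_all assms)
     (metis assms(1) image_eqI lessThan_iff less_one nested_code_def)
next
  case (Suc m)
  show ?case
  proof (cases "j = Suc m")
    case True
    then show ?thesis
      using length_multi_indices[OF nested_code_in[OF assms(1) Suc(3,4)]] Suc by simp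
  next
    case False
    obtain p i where p: "p < \<rho> m" "i < d (Suc m)" "e (Suc m) l = e m p @ [i]"
      using assms(1) Suc unfolding nested_code_def by (metis Suc_le_eq)
    have "length (e m p) = m"
      using length_multi_indices[OF nested_code_in[OF assms(1), of m p]] Suc p by simp
    then have "take j (e (Suc m) l) = take j (e m p)" using p False Suc by simp
    then show ?thesis using Suc False p by auto
  qed
qed


lemma rev_eq_rev_snoc_iff: "rev ys = rev xs @ [i] \<longleftrightarrow> ys = i # xs"
  by (metis rev.simps(2) rev_is_rev_conv)

text \<open>The mirror image of \<open>nested_code\<close>, with indices counted from the right end: \<open>t j p\<close> labels the rank
  index \<open>p < \<rho> j\<close> by a multi-index over the modes \<open>j + 1, \<dots>, M\<close>. Reversing the words and the
  order of the modes turns one notion into the other, which transfers the constructions above.\<close>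

definition suffix_code :: "(nat \<Rightarrow> nat) \<Rightarrow> (nat \<Rightarrow> nat) \<Rightarrow> nat \<Rightarrow> nat \<Rightarrow> (nat \<Rightarrow> nat \<Rightarrow> nat list) \<Rightarrow> bool" where
  "suffix_code \<rho> d M k t \<longleftrightarrow> \<rho> M = 1 \<and> t M 0 = [] \<and> (\<forall>j. k \<le> j \<and> j \<le> M \<longrightarrow> inj_on (t j) {..<\<rho> j}) \<and>
     (\<forall>j. k \<le> j \<and> j < M \<longrightarrow> (\<forall>p<\<rho> j. \<exists>l<\<rho> (Suc j). \<exists>i<d (Suc j). t j p = i # t (Suc j) l))"

lemma suffix_code_iff_nested_code:
  assumes "k \<le> M"
  shows "suffix_code \<rho> d M k t \<longleftrightarrow>
    nested_code (\<lambda>j. \<rho> (M - j)) (\<lambda>j. d (Suc M - j)) (M - k) (\<lambda>j l. rev (t (M - j) l))"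
proof -
  have reindex: "(\<forall>j. k \<le> j \<and> j \<le> M \<longrightarrow> P j) \<longleftrightarrow> (\<forall>j\<le>M - k. P (M - j))" for P
    using assms by (metis diff_diff_cancel diff_le_mono2 diff_le_self le_diff_iff' le_trans)
  have reindex': "(\<forall>j. k \<le> j \<and> j < M \<longrightarrow> P j (Suc j)) \<longleftrightarrow> (\<forall>j<M - k. P (M - Suc j) (M - j))" for P
  proof safe
    fix j assume "\<forall>j. k \<le> j \<and> j < M \<longrightarrow> P j (Suc j)" "j < M - k"
    moreover from this have "k \<le> M - Suc j" "M - Suc j < M" "Suc (M - Suc j) = M - j" by auto
    ultimately show "P (M - Suc j) (M - j)" by metis
  next
    fix j assume "\<forall>j<M - k. P (M - Suc j) (M - j)" "k \<le> j" "j < M"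
    moreover from this have "M - Suc j < M - k" "M - Suc (M - Suc j) = j" "M - (M - Suc j) = Suc j" by auto
    ultimately show "P j (Suc j)" by metis
  qed
  have inj: "inj_on (\<lambda>l. rev (t j l)) N \<longleftrightarrow> inj_on (t j) N" for j N
    by (auto simp: inj_on_def)
  show ?thesis
    unfolding suffix_code_def nested_code_def reindex inj rev_eq_rev_snoc_iff
      reindex'[of "\<lambda>j j'. \<forall>p<\<rho> j. \<exists>l<\<rho> j'. \<exists>i<d j'. t j p = i # t j' l"]
    by simp
qed

lemma suffix_code_in:
  assumes "suffix_code \<rho> d M k t" "k \<le> j" "j \<le> M" "p < \<rho> j"
  shows "t j p \<in> multi_indices (map d [Suc j..<Suc M])"
  using assms(3,2,4)
proof (induction j arbitrary: p rule: inc_induct)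
  case base
  then show ?case using assms(1) by (simp add: suffix_code_def multi_indices_Nil)
next
  case (step j)
  then obtain l i where "l < \<rho> (Suc j)" "i < d (Suc j)" "t j p = i # t (Suc j) l"
    using assms(1) unfolding suffix_code_def by metis
  moreover have "[Suc j..<Suc M] = Suc j # [Suc (Suc j)..<Suc M]"
    using step by (intro upt_conv_Cons) simp
  ultimately show ?case using step by (simp add: multi_indices_Cons)
qed

lemma suffix_code_drop:
  assumes "suffix_code \<rho> d M k t" "k \<le> j" "j \<le> M" "p < \<rho> k"
  shows "drop (j - k) (t k p) \<in> t j ` {..<\<rho> j}"
  using assms(2,3)
proof (induction j rule: dec_induct)
  case base
  then show ?case using assms by simp
next
  case (step j)
  then obtain q where q: "q < \<rho> j" "drop (j - k) (t k p) = t j q" by auto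
  then obtain l i where "l < \<rho> (Suc j)" "t j q = i # t (Suc j) l"
    using assms(1) step unfolding suffix_code_def by (metis Suc_le_eq)
  moreover have "drop (Suc j - k) (t k p) = tl (drop (j - k) (t k p))"
    using step by (simp add: Suc_diff_le tl_drop drop_Suc)
  ultimately show ?case using q by auto
qed

section \<open>Contractions of selecting cores\<close>

text \<open>The contraction sums over all intermediate rank indices. Only the one whose label is the prefix of
  the label of \<open>l\<close> contributes, so the contraction tests whether the label of \<open>l\<close> is the given
  multi-index. The leading \<open>0\<close> is the index of the mode of size \<open>\<rho> 0 = 1\<close>.\<close>

lemma contract_cores_nested_code:
  assumes code: "nested_code \<rho> d n e"
    and X: "\<And>j p i l. j < n \<Longrightarrow> p < \<rho> j \<Longrightarrow> i < d (Suc j) \<Longrightarrow> l < \<rho> (Suc j) \<Longrightarrow>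
      X (Suc j) [p, i, l] = of_bool (e (Suc j) l = e j p @ [i])"
    and "Suc m \<le> n" "is \<in> multi_indices (map d [1..<m + 2])" "l < \<rho> (Suc m)"
  shows "contract_cores \<rho> X 1 (Suc m) (0 # is @ [l]) = of_bool (e (Suc m) l = is)"
  using assms(3-)
proof (induction m arbitrary: "is" l)
  case 0
  then obtain i where "is = [i]" "i < d 1"
    by (auto simp: multi_indices_Cons multi_indices_Nil)
  then show ?case using X[of 0 0 i l] 0 code by (simp add: nested_code_def)
next
  case (Suc m)
  have "map d [1..<Suc m + 2] = map d [1..<m + 2] @ [d (Suc (Suc m))]" by simp
  with Suc.prems(2) have "is \<in> multi_indices (map d [1..<m + 2] @ [d (Suc (Suc m))])" by (simp only:)
  then obtain js i where is_eq: "is = js @ [i]" and js: "js \<in> multi_indices (map d [1..<m + 2])"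
    and i: "i < d (Suc (Suc m))"
    by (rule multi_indices_snocE)
  have len: "length js = Suc m" using length_multi_indices[OF js] by simp
  obtain q i' where q: "q < \<rho> (Suc m)" "e (Suc (Suc m)) l = e (Suc m) q @ [i']"
    using code Suc.prems unfolding nested_code_def by (metis Suc_le_eq)
  have inj: "inj_on (e (Suc m)) {..<\<rho> (Suc m)}"
    using code Suc.prems unfolding nested_code_def by simp
  have "contract_cores \<rho> X 1 (Suc (Suc m)) (0 # is @ [l]) =
      (\<Sum>p<\<rho> (Suc m). contract_cores \<rho> X 1 (Suc m) (0 # js @ [p]) * X (Suc (Suc m)) [p, i, l])"
    using len by (simp add: contract_def is_eq)
  also have "\<dots> = (\<Sum>p<\<rho> (Suc m). of_bool (e (Suc m) p = js) * of_bool (e (Suc (Suc m)) l = e (Suc m) p @ [i]))"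
    using Suc js i by (intro sum.cong) (auto simp: X)
  also have "\<dots> = (\<Sum>p<\<rho> (Suc m). if p = q then of_bool (e (Suc (Suc m)) l = is) else 0)"
    using q inj by (intro sum.cong) (auto simp: is_eq inj_on_def)
  also have "\<dots> = of_bool (e (Suc (Suc m)) l = is)"
    using q by simp
  finally show ?case .
qed

text \<open>Contractions are built from left to right, whereas suffix labels grow from right to left. Hence
  the statement for an incomplete chain compares the label of \<open>p\<close> with the consumed indices followed
  by the label of the open rank index \<open>l\<close>. In the induction step the only contributing
  intermediate index is the one labelled by the remaining suffix of the label of \<open>p\<close>.\<close>

lemma contract_cores_suffix_code:
  assumes code: "suffix_code \<rho> d M k t"
    and X: "\<And>j p i l. k \<le> j \<Longrightarrow> j < M \<Longrightarrow> p < \<rho> j \<Longrightarrow> i < d (Suc j) \<Longrightarrow> l < \<rho> (Suc j) \<Longrightarrow>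
      X (Suc j) [p, i, l] = of_bool (t j p = i # t (Suc j) l)"
    and "k + Suc m \<le> M" "is \<in> multi_indices (map d [k + 1..<k + m + 2])" "p < \<rho> k" "l < \<rho> (k + Suc m)"
  shows "contract_cores \<rho> X (k + 1) (Suc m) (p # is @ [l]) = of_bool (t k p = is @ t (k + Suc m) l)"
  using assms(3-)
proof (induction m arbitrary: "is" l)
  case 0
  then obtain i where "is = [i]" "i < d (Suc k)"
    by (auto simp: multi_indices_Cons multi_indices_Nil)
  then show ?case using X[of k p i l] 0 by simp
next
  case (Suc m)
  let ?j = "k + Suc m"
  have "map d [k + 1..<k + Suc m + 2] = map d [k + 1..<k + m + 2] @ [d (Suc ?j)]" by simp
  with Suc.prems(2) have "is \<in> multi_indices (map d [k + 1..<k + m + 2] @ [d (Suc ?j)])" by (simp only:)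
  then obtain js i where is_eq: "is = js @ [i]" and js: "js \<in> multi_indices (map d [k + 1..<k + m + 2])"
    and i: "i < d (Suc ?j)"
    by (rule multi_indices_snocE)
  have len: "length js = Suc m" using length_multi_indices[OF js] by simp
  have "drop (?j - k) (t k p) \<in> t ?j ` {..<\<rho> ?j}"
    using suffix_code_drop[OF code, of ?j p] Suc.prems by simp
  then obtain q where q: "q < \<rho> ?j" "drop (Suc m) (t k p) = t ?j q" by auto
  have len_t: "length (t k p) = M - k"
    using length_multi_indices[OF suffix_code_in[OF code, of k p]] Suc.prems by simp
  define ks where "ks = take (Suc m) (t k p)"
  have t_eq: "t k p = ks @ t ?j q" using q by (metis append_take_drop_id ks_def)
  have len_ks: "length ks = Suc m" using len_t Suc.prems by (simp add: ks_def)
  have inj: "inj_on (t ?j) {..<\<rho> ?j}"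
    using code Suc.prems unfolding suffix_code_def by simp
  have "contract_cores \<rho> X (k + 1) (Suc (Suc m)) (p # is @ [l]) =
      (\<Sum>q<\<rho> ?j. contract_cores \<rho> X (k + 1) (Suc m) (p # js @ [q]) * X (Suc ?j) [q, i, l])"
    using len by (simp add: contract_def is_eq)
  also have "\<dots> = (\<Sum>q<\<rho> ?j. of_bool (t k p = js @ t ?j q) * of_bool (t ?j q = i # t (Suc ?j) l))"
    using Suc js i by (intro sum.cong) (auto simp: X)
  also have "\<dots> = (\<Sum>q'<\<rho> ?j. if q' = q then of_bool (t k p = is @ t (Suc ?j) l) else 0)"
    using q inj len len_ks by (intro sum.cong) (auto simp: is_eq t_eq inj_on_def)
  also have "\<dots> = of_bool (t k p = is @ t (k + Suc (Suc m)) l)"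
    using q by simp
  finally show ?case .
qed

section \<open>Selection matrices\<close>

text \<open>The column of \<open>Q\<close> at the multi-index \<open>y\<close> is the unit vector at \<open>\<phi> y\<close>, or zero if \<open>\<phi> y\<close> lies
  outside the index set.\<close>

definition selection_matrix :: "nat list \<Rightarrow> nat list \<Rightarrow> (nat list \<Rightarrow> nat list) \<Rightarrow> real mat \<Rightarrow> bool" where
  "selection_matrix ds es \<phi> Q \<longleftrightarrow> Q \<in> carrier_mat (prod_list ds) (prod_list es) \<and>
     (\<forall>p<prod_list ds. \<forall>q<prod_list es.
        Q $$ (p, q) = of_bool (multi_index_at ds p = \<phi> (multi_index_at es q)))"

lemma selection_matrix_cong:
  assumes "\<And>y. y \<in> multi_indices es \<Longrightarrow> \<phi> y = \<psi> y"
  shows "selection_matrix ds es \<phi> Q \<longleftrightarrow> selection_matrix ds es \<psi> Q"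
  using assms multi_index_at_in[of _ es] by (simp add: selection_matrix_def)

lemma selection_matrix_one: "selection_matrix [n] [n] (\<lambda>y. y) (1\<^sub>m n)"
  by (simp add: selection_matrix_def)

text \<open>The length condition makes the concatenation of the two selected multi-indices unambiguous, so that
  the product of the two tests is the test for the concatenation.\<close>

lemma selection_matrix_kronecker:
  assumes A: "selection_matrix ds es \<phi> A" and B: "selection_matrix ds' es' \<psi> B"
    and len: "\<And>y. y \<in> multi_indices es \<Longrightarrow> length (\<phi> y) = length ds"
  shows "selection_matrix (ds @ ds') (es @ es')
    (\<lambda>y. \<phi> (take (length es) y) @ \<psi> (drop (length es) y)) (kronecker A B)"
proof -
  have cA: "A \<in> carrier_mat (prod_list ds) (prod_list es)"
    and cB: "B \<in> carrier_mat (prod_list ds') (prod_list es')"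
    using A B by (auto simp: selection_matrix_def)
  have ent: "kronecker A B $$ (p, q) = of_bool (multi_index_at (ds @ ds') p =
      \<phi> (take (length es) (multi_index_at (es @ es') q)) @ \<psi> (drop (length es) (multi_index_at (es @ es') q)))"
    if p: "p < prod_list (ds @ ds')" and q: "q < prod_list (es @ es')" for p q
  proof -
    have bp: "p div prod_list ds' < prod_list ds" "p mod prod_list ds' < prod_list ds'"
      using p by (auto simp: less_mult_imp_div_less intro!: mod_less_divisor gr0I)
    have bq: "q div prod_list es' < prod_list es" "q mod prod_list es' < prod_list es'"
      using q by (auto simp: less_mult_imp_div_less intro!: mod_less_divisor gr0I)
    have l: "length (multi_index_at es (q div prod_list es')) = length es"
      "length (multi_index_at ds (p div prod_list ds')) = length (\<phi> (multi_index_at es (q div prod_list es')))"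
      using bp bq by (simp_all add: len multi_index_at_in length_multi_indices)
    have "kronecker A B $$ (p, q) = A $$ (p div prod_list ds', q div prod_list es') * B $$ (p mod prod_list ds', q mod prod_list es')"
      using p q cA cB by (simp add: kronecker_def)
    also have "\<dots> = of_bool (multi_index_at ds (p div prod_list ds') = \<phi> (multi_index_at es (q div prod_list es')) \<and>
        multi_index_at ds' (p mod prod_list ds') = \<psi> (multi_index_at es' (q mod prod_list es')))"
      using A B bp bq by (simp add: selection_matrix_def)
    finally show ?thesis
      using l by (simp add: multi_index_at_append[OF p] multi_index_at_append[OF q])
  qed
  moreover have "kronecker A B \<in> carrier_mat (prod_list (ds @ ds')) (prod_list (es @ es'))"
    using cA cB by (simp add: kronecker_def)
  ultimately show ?thesis by (simp add: selection_matrix_def)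
qed


text \<open>If \<open>\<phi>\<close> is injective and stays inside the index set, the operator \<open>Q\<close> moves the entry of \<open>C\<close> at \<open>y\<close> to \<open>\<phi> y\<close> and fills up with zeros,
  and \<open>(Q\<^sup>T \<omega>)\<^sub>y = \<omega>\<^bsub>\<phi> y\<^esub>\<close>. Therefore \<open>C\<close> is determined by its image, and the weighted norm of \<open>C\<close>
  depends only on that image.\<close>

lemma operator_image_selection_iff:
  assumes Q: "selection_matrix ds es \<phi> Q"
    and inj: "inj_on \<phi> (multi_indices es)" and im: "\<phi> ` multi_indices es \<subseteq> multi_indices ds"
  shows "A \<in> operator_image ds es Q (weighted_cores ds es Q r \<omega>) \<longleftrightarrow>
    A \<in> tensors ds \<and> {x. A x \<noteq> 0} \<subseteq> \<phi> ` multi_indices es \<and> (\<Sum>x\<in>{x. A x \<noteq> 0}. (\<omega> x)\<^sup>2) \<le> ennreal r"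
proof -
  have cQ: "Q \<in> carrier_mat (prod_list ds) (prod_list es)"
    and ent: "\<And>p q. p < prod_list ds \<Longrightarrow> q < prod_list es \<Longrightarrow>
      Q $$ (p, q) = of_bool (multi_index_at ds p = \<phi> (multi_index_at es q))"
    using Q by (auto simp: selection_matrix_def)
  have image_at: "multi_index_at fs ` {..<prod_list fs} = multi_indices fs" for fs
    using bij_betw_multi_index_at by (auto simp: bij_betw_def)
  have apply_at: "(Q *\<^sub>v vectorise es C) $ p = (\<Sum>y\<in>multi_indices es. of_bool (multi_index_at ds p = \<phi> y) * C y)"
    if "p < prod_list ds" for p C
  proof -
    have "(Q *\<^sub>v vectorise es C) $ p =
        (\<Sum>q<prod_list es. of_bool (multi_index_at ds p = \<phi> (multi_index_at es q)) * C (multi_index_at es q))"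
      using cQ ent that by (auto simp: scalar_prod_def vectorise_def atLeast0LessThan intro!: sum.cong)
    also have "\<dots> = (\<Sum>y\<in>multi_indices es. of_bool (multi_index_at ds p = \<phi> y) * C y)"
      by (rule sum_multi_index_at[where f = "\<lambda>y. of_bool (multi_index_at ds p = \<phi> y) * C y"])
    finally show ?thesis .
  qed
  have apply_iff: "vectorise ds A = Q *\<^sub>v vectorise es C \<longleftrightarrow>
      (\<forall>x\<in>multi_indices ds. A x = (\<Sum>y\<in>multi_indices es. of_bool (x = \<phi> y) * C y))" for C
  proof -
    have "vectorise ds A = Q *\<^sub>v vectorise es C \<longleftrightarrow>
        (\<forall>p\<in>{..<prod_list ds}. A (multi_index_at ds p) = (Q *\<^sub>v vectorise es C) $ p)"
      using cQ by (auto simp: vec_eq_iff vectorise_def simp del: index_mult_mat_vec)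
    then show ?thesis by (simp add: apply_at flip: image_at)
  qed
  have apply_image: "(\<Sum>y'\<in>multi_indices es. of_bool (\<phi> y = \<phi> y') * C y') = C y"
    if "y \<in> multi_indices es" for y and C :: "nat list \<Rightarrow> real"
  proof -
    have "(\<Sum>y'\<in>multi_indices es. of_bool (\<phi> y = \<phi> y') * C y') = (\<Sum>y'\<in>multi_indices es. if y' = y then C y else 0)"
      using inj that by (intro sum.cong) (auto simp: inj_on_def)
    then show ?thesis using that finite_multi_indices by simp
  qed
  have apply_off: "(\<Sum>y\<in>multi_indices es. of_bool (x = \<phi> y) * C y) = 0"
    if "x \<notin> \<phi> ` multi_indices es" for x and C :: "nat list \<Rightarrow> real"
    using that by (intro sum.neutral) auto
  have weight: "(map_mat ennreal (transpose_mat Q) *\<^sub>v vectorise ds \<omega>) $ q = \<omega> (\<phi> (multi_index_at es q))"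
    if q: "q < prod_list es" for q
  proof -
    have "(map_mat ennreal (transpose_mat Q) *\<^sub>v vectorise ds \<omega>) $ q =
        (\<Sum>p<prod_list ds. ennreal (Q $$ (p, q)) * \<omega> (multi_index_at ds p))"
      using cQ q by (auto simp: scalar_prod_def vectorise_def atLeast0LessThan intro!: sum.cong)
    also have "\<dots> = (\<Sum>p<prod_list ds. of_bool (multi_index_at ds p = \<phi> (multi_index_at es q)) * \<omega> (multi_index_at ds p))"
      using q by (intro sum.cong) (auto simp: ent)
    also have "\<dots> = (\<Sum>x\<in>multi_indices ds. of_bool (x = \<phi> (multi_index_at es q)) * \<omega> x)"
      by (rule sum_multi_index_at[where f = "\<lambda>x. of_bool (x = \<phi> (multi_index_at es q)) * \<omega> x"])
    also have "\<dots> = (\<Sum>x\<in>multi_indices ds. if x = \<phi> (multi_index_at es q) then \<omega> x else 0)"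
      by (intro sum.cong) auto
    also have "\<dots> = \<omega> (\<phi> (multi_index_at es q))"
      using im multi_index_at_in[OF q] finite_multi_indices by auto
    finally show ?thesis .
  qed
  have norm: "l0_norm (map_mat ennreal (transpose_mat Q) *\<^sub>v vectorise ds \<omega>) (vectorise es C) =
      (\<Sum>x\<in>\<phi> ` {y \<in> multi_indices es. C y \<noteq> 0}. (\<omega> x)\<^sup>2)" for C
  proof -
    have vec_at: "dim_vec (vectorise es C) = prod_list es"
      "\<And>q. q < prod_list es \<Longrightarrow> vectorise es C $ q = C (multi_index_at es q)"
      by (simp_all add: vectorise_def)
    have bij: "bij_betw (multi_index_at es) {q. q < prod_list es \<and> C (multi_index_at es q) \<noteq> 0}
        {y \<in> multi_indices es. C y \<noteq> 0}"
      by (rule bij_betw_subset[OF bij_betw_multi_index_at]) (auto simp flip: image_at)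
    have "l0_norm (map_mat ennreal (transpose_mat Q) *\<^sub>v vectorise ds \<omega>) (vectorise es C) =
        (\<Sum>q\<in>{q. q < prod_list es \<and> C (multi_index_at es q) \<noteq> 0}. (\<omega> (\<phi> (multi_index_at es q)))\<^sup>2)"
      unfolding l0_norm_def
      by (rule sum.cong) (auto simp: vec_at weight simp del: index_mult_mat_vec)
    also have "\<dots> = (\<Sum>y\<in>{y \<in> multi_indices es. C y \<noteq> 0}. (\<omega> (\<phi> y))\<^sup>2)"
      by (rule sum.reindex_bij_betw[OF bij, of "\<lambda>y. (\<omega> (\<phi> y))\<^sup>2"])
    also have "\<dots> = (\<Sum>x\<in>\<phi> ` {y \<in> multi_indices es. C y \<noteq> 0}. (\<omega> x)\<^sup>2)"
      using inj by (subst sum.reindex) (auto intro: inj_on_subset)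
    finally show ?thesis .
  qed
  show ?thesis
  proof
    assume "A \<in> operator_image ds es Q (weighted_cores ds es Q r \<omega>)"
    then obtain C where A: "A \<in> tensors ds"
      and le: "(\<Sum>x\<in>\<phi> ` {y \<in> multi_indices es. C y \<noteq> 0}. (\<omega> x)\<^sup>2) \<le> ennreal r"
      and eq: "\<forall>x\<in>multi_indices ds. A x = (\<Sum>y\<in>multi_indices es. of_bool (x = \<phi> y) * C y)"
      by (auto simp: operator_image_def weighted_cores_def norm apply_iff)
    have on: "A (\<phi> y) = C y" if "y \<in> multi_indices es" for y
      using eq apply_image[OF that] im that by auto
    have off: "A x = 0" if "x \<notin> \<phi> ` multi_indices es" for x
      using eq apply_off[OF that] A by (cases "x \<in> multi_indices ds") (auto simp: tensors_def)
    have "{x. A x \<noteq> 0} = \<phi> ` {y \<in> multi_indices es. C y \<noteq> 0}"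
      using on off by (auto simp: image_iff) metis
    with A le show "A \<in> tensors ds \<and> {x. A x \<noteq> 0} \<subseteq> \<phi> ` multi_indices es \<and>
        (\<Sum>x\<in>{x. A x \<noteq> 0}. (\<omega> x)\<^sup>2) \<le> ennreal r" by auto
  next
    assume A: "A \<in> tensors ds \<and> {x. A x \<noteq> 0} \<subseteq> \<phi> ` multi_indices es \<and>
        (\<Sum>x\<in>{x. A x \<noteq> 0}. (\<omega> x)\<^sup>2) \<le> ennreal r"
    define C where "C = (\<lambda>y. if y \<in> multi_indices es then A (\<phi> y) else 0)"
    have "\<forall>x\<in>multi_indices ds. A x = (\<Sum>y\<in>multi_indices es. of_bool (x = \<phi> y) * C y)"
    proof
      fix x assume "x \<in> multi_indices ds"
      show "A x = (\<Sum>y\<in>multi_indices es. of_bool (x = \<phi> y) * C y)"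
      proof (cases "x \<in> \<phi> ` multi_indices es")
        case True
        then show ?thesis using apply_image by (auto simp: C_def)
      next
        case False
        then show ?thesis using apply_off A by auto
      qed
    qed
    moreover have "\<phi> ` {y \<in> multi_indices es. C y \<noteq> 0} = {x. A x \<noteq> 0}"
      using A by (auto simp: C_def)
    moreover have "C \<in> tensors es" by (simp add: C_def tensors_def)
    ultimately show "A \<in> operator_image ds es Q (weighted_cores ds es Q r \<omega>)"
      using A by (auto simp: operator_image_def weighted_cores_def norm apply_iff intro!: bexI[of _ C])
  qed
qed

section \<open>The operators of the model are selections\<close>

text \<open>The position in the full tensor that belongs to the core entry \<open>[a, b, c]\<close>: the prefix label of \<open>a\<close>,
  the index \<open>b\<close> itself, and the suffix label of \<open>c\<close>.\<close>

definition code_index :: "(nat \<Rightarrow> nat list) \<Rightarrow> (nat \<Rightarrow> nat list) \<Rightarrow> nat list \<Rightarrow> nat list" where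
  "code_index f g y = f (y ! 0) @ (y ! 1) # g (y ! 2)"

lemma map_upt_split:
  assumes "1 \<le> k" "k \<le> M"
  shows "map d [1..<M + 1] = map d [1..<k] @ d k # map d [k + 1..<M + 1]"
  using assms upt_add_eq_append[of 1 k "M + 1 - k"] upt_conv_Cons[of k "M + 1"] by simp

lemma code_index_image_inj:
  assumes k: "1 \<le> k" "k \<le> M" and e: "nested_code \<rho> d (k - 1) e" and t: "suffix_code \<rho> d M k t"
  shows "code_index (e (k - 1)) (t k) ` multi_indices [\<rho> (k - 1), d k, \<rho> k] \<subseteq> multi_indices (map d [1..<M + 1])"
    and "inj_on (code_index (e (k - 1)) (t k)) (multi_indices [\<rho> (k - 1), d k, \<rho> k])"
proof -
  have e_in: "e (k - 1) a \<in> multi_indices (map d [1..<k])" if "a < \<rho> (k - 1)" for a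
    using nested_code_in[OF e _ that] k by simp
  have t_in: "t k c \<in> multi_indices (map d [k + 1..<M + 1])" if "c < \<rho> k" for c
    using suffix_code_in[OF t _ _ that] k by simp
  show "code_index (e (k - 1)) (t k) ` multi_indices [\<rho> (k - 1), d k, \<rho> k] \<subseteq> multi_indices (map d [1..<M + 1])"
    unfolding map_upt_split[OF k] multi_indices_append multi_indices_Cons multi_indices_Nil
    using e_in t_in by (fastforce simp: code_index_def)
  have len: "length (e (k - 1) a) = k - 1" if "a < \<rho> (k - 1)" for a
    using length_multi_indices[OF e_in[OF that]] by simp
  have "inj_on (e (k - 1)) {..<\<rho> (k - 1)}" "inj_on (t k) {..<\<rho> k}"
    using e t k by (auto simp: nested_code_def suffix_code_def)
  then show "inj_on (code_index (e (k - 1)) (t k)) (multi_indices [\<rho> (k - 1), d k, \<rho> k])"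
    unfolding multi_indices_append multi_indices_Cons multi_indices_Nil
    by (auto simp: inj_on_def code_index_def len[unfolded One_nat_def])
qed

abbreviation core_matrix where
  "core_matrix M d k \<rho> U V \<equiv>
    kronecker
      (kronecker (unfold (cores_shape \<rho> d 1 (k - 1)) k (contract_cores \<rho> U 1 (k - 1))) (1\<^sub>m (d k)))
      (transpose_mat (unfold (cores_shape \<rho> d (k + 1) (M - k)) 1 (contract_cores \<rho> V (k + 1) (M - k))))"

lemma left_factor_selection:
  assumes k: "1 \<le> k" and e: "nested_code \<rho> d (k - 1) e"
    and U: "\<And>j p i l. j < k - 1 \<Longrightarrow> p < \<rho> j \<Longrightarrow> i < d (Suc j) \<Longrightarrow> l < \<rho> (Suc j) \<Longrightarrow>
      U (Suc j) [p, i, l] = of_bool (e (Suc j) l = e j p @ [i])"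
  shows "selection_matrix (map d [1..<k]) [\<rho> (k - 1)] (\<lambda>y. e (k - 1) (y ! 0))
    (unfold (cores_shape \<rho> d 1 (k - 1)) k (contract_cores \<rho> U 1 (k - 1)))"
proof (cases "k = 1")
  case True
  then show ?thesis using e
    by (auto simp: selection_matrix_def cores_shape_def unfold_def vectorise_def nested_code_def)
next
  case False
  then obtain m where m: "k = m + 2" using k by (metis add.commute add_2_eq_Suc le_neq_implies_less less_eqE one_add_one plus_1_eq_Suc Suc_leI)
  have \<rho>0: "\<rho> 0 = 1" using e by (simp add: nested_code_def)
  define xs where "xs = map d [1..<k]"
  have shape: "cores_shape \<rho> d 1 (k - 1) = (1 # xs) @ [\<rho> (k - 1)]"
    using m \<rho>0 by (simp add: cores_shape_def xs_def)
  have len: "k = length (1 # xs)" using m by (simp add: xs_def)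
  define W where "W = unfold (cores_shape \<rho> d 1 (k - 1)) k (contract_cores \<rho> U 1 (k - 1))"
  have W: "W = unfold ((1 # xs) @ [\<rho> (k - 1)]) (length (1 # xs)) (contract_cores \<rho> U 1 (k - 1))"
    using shape len by (simp add: W_def)
  have "W \<in> carrier_mat (prod_list xs) (\<rho> (k - 1))"
    using unfold_carrier[of "1 # xs" "[\<rho> (k - 1)]"] by (simp add: W)
  moreover have "W $$ (p, q) = of_bool (multi_index_at xs p = e (k - 1) q)"
    if p: "p < prod_list xs" and q: "q < \<rho> (k - 1)" for p q
  proof -
    have "W $$ (p, q) = contract_cores \<rho> U 1 (Suc m) (0 # multi_index_at xs p @ [q])"
      using unfold_entry[of p "1 # xs" q "[\<rho> (k - 1)]"] p q by (simp add: W m)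
    also have "\<dots> = of_bool (e (Suc m) q = multi_index_at xs p)"
      using multi_index_at_in[OF p] q m unfolding xs_def by (intro contract_cores_nested_code[OF e U]) auto
    finally show ?thesis by (auto simp: m)
  qed
  ultimately show ?thesis 
    unfolding selection_matrix_def W_def[symmetric] xs_def[symmetric] by auto
qed

lemma right_factor_selection:
  assumes k: "k \<le> M" and t: "suffix_code \<rho> d M k t"
    and V: "\<And>j p i l. k \<le> j \<Longrightarrow> j < M \<Longrightarrow> p < \<rho> j \<Longrightarrow> i < d (Suc j) \<Longrightarrow> l < \<rho> (Suc j) \<Longrightarrow>
      V (Suc j) [p, i, l] = of_bool (t j p = i # t (Suc j) l)"
  shows "selection_matrix (map d [k + 1..<M + 1]) [\<rho> k] (\<lambda>y. t k (y ! 0))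
    (transpose_mat (unfold (cores_shape \<rho> d (k + 1) (M - k)) 1 (contract_cores \<rho> V (k + 1) (M - k))))"
proof (cases "k = M")
  case True
  then show ?thesis using t
    by (auto simp: selection_matrix_def cores_shape_def unfold_def vectorise_def suffix_code_def)
next
  case False
  then obtain m where m: "M = k + Suc m" using k by (metis le_neq_implies_less less_imp_Suc_add add_Suc_right)
  have \<rho>M: "\<rho> M = 1" "t M 0 = []" using t by (auto simp: suffix_code_def)
  define xs where "xs = map d [k + 1..<M + 1]"
  have shape: "cores_shape \<rho> d (k + 1) (M - k) = [\<rho> k] @ (xs @ [1])"
    using m \<rho>M by (simp add: cores_shape_def xs_def)
  define W where "W = unfold (cores_shape \<rho> d (k + 1) (M - k)) 1 (contract_cores \<rho> V (k + 1) (M - k))"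
  have W: "W = unfold ([\<rho> k] @ (xs @ [1])) (length [\<rho> k]) (contract_cores \<rho> V (k + 1) (M - k))"
    using shape by (simp add: W_def)
  have "W \<in> carrier_mat (\<rho> k) (prod_list xs)"
    using unfold_carrier[of "[\<rho> k]" "xs @ [1]"] unfolding W by simp
  moreover have "W $$ (p, q) = of_bool (multi_index_at xs q = t k p)"
    if q: "q < prod_list xs" and p: "p < \<rho> k" for p q
  proof -
    have "W $$ (p, q) = contract_cores \<rho> V (k + 1) (Suc m) (p # multi_index_at xs q @ [0])"
      using unfold_entry[of p "[\<rho> k]" q "xs @ [1]"] p q multi_index_at_append[of q xs "[1]"]
      unfolding W by (simp add: m)
    also have "\<dots> = of_bool (t k p = multi_index_at xs q @ t (k + Suc m) 0)"
      using multi_index_at_in[OF q] p m \<rho>M unfolding xs_def by (intro contract_cores_suffix_code[OF t V]) auto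
    finally show ?thesis using \<rho>M by (auto simp: m)
  qed
  ultimately show ?thesis 
    unfolding selection_matrix_def W_def[symmetric] xs_def[symmetric] by auto
qed

text \<open>The three Kronecker factors select the prefix label, the free index, and the suffix label.\<close>

lemma core_matrix_selection:
  assumes k: "1 \<le> k" "k \<le> M" and e: "nested_code \<rho> d (k - 1) e" and t: "suffix_code \<rho> d M k t"
    and U: "\<And>j p i l. j < k - 1 \<Longrightarrow> p < \<rho> j \<Longrightarrow> i < d (Suc j) \<Longrightarrow> l < \<rho> (Suc j) \<Longrightarrow>
      U (Suc j) [p, i, l] = of_bool (e (Suc j) l = e j p @ [i])"
    and V: "\<And>j p i l. k \<le> j \<Longrightarrow> j < M \<Longrightarrow> p < \<rho> j \<Longrightarrow> i < d (Suc j) \<Longrightarrow> l < \<rho> (Suc j) \<Longrightarrow>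
      V (Suc j) [p, i, l] = of_bool (t j p = i # t (Suc j) l)"
  shows "selection_matrix (map d [1..<M + 1]) [\<rho> (k - 1), d k, \<rho> k] (code_index (e (k - 1)) (t k)) (core_matrix M d k \<rho> U V)"
proof -
  have len: "length (e (k - 1) a) = k - 1" if "a < \<rho> (k - 1)" for a
    using length_multi_indices[OF nested_code_in[OF e _ that]] by (simp del: upt_Suc)
  note s1 = selection_matrix_kronecker[OF left_factor_selection[where U = U, OF k(1) e U] selection_matrix_one[of "d k"]]
  note s2 = selection_matrix_kronecker[OF s1 right_factor_selection[where V = V, OF k(2) t V]]
  show ?thesis
    unfolding map_upt_split[OF k]
    by (rule selection_matrix_cong[THEN iffD1, rotated, OF s2[unfolded append_assoc append.simps]])
      (auto simp: multi_indices_Cons multi_indices_Nil code_index_def len[unfolded One_nat_def])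
qed


text \<open>Rank bounds are only imposed through the cores, hence the guards \<open>1 < k\<close> and \<open>k < M\<close>: without cores
  on one side, the only rank there is the boundary rank \<open>1\<close>, which \<open>R\<close> does not bound.\<close>

lemma sparse_ops_codes:
  assumes "(es, Q) \<in> sparse_ops M d R k" and k: "1 \<le> k" "k \<le> M"
  obtains \<rho> e t where "es = [\<rho> (k - 1), d k, \<rho> k]"
    and "nested_code \<rho> d (k - 1) e" and "suffix_code \<rho> d M k t"
    and "\<And>j. 1 < k \<Longrightarrow> j < k \<Longrightarrow> \<rho> j \<le> R" and "\<And>j. k < M \<Longrightarrow> k \<le> j \<Longrightarrow> j \<le> M \<Longrightarrow> \<rho> j \<le> R"
    and "selection_matrix (map d [1..<M + 1]) es (code_index (e (k - 1)) (t k)) Q"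
proof -
  obtain \<rho> U V where \<rho>: "\<rho> 0 = 1" "\<rho> M = 1" and es: "es = [\<rho> (k - 1), d k, \<rho> k]"
    and U: "\<forall>j\<in>{1..<k}. \<rho> (j - 1) \<le> R \<and> \<rho> j \<le> R \<and> range (U j) \<subseteq> {0, 1} \<and>
      left_orthogonal [\<rho> (j - 1), d j, \<rho> j] (U j)"
    and V: "\<forall>j\<in>{k<..M}. \<rho> (j - 1) \<le> R \<and> \<rho> j \<le> R \<and> range (V j) \<subseteq> {0, 1} \<and>
      right_orthogonal [\<rho> (j - 1), d j, \<rho> j] (V j)"
    and Q: "Q = core_matrix M d k \<rho> U V"
    using assms(1) unfolding sparse_ops_def Let_def by blast
  have "\<exists>g. slice_selection (\<rho> j) (d (Suc j)) (\<rho> (Suc j)) (\<lambda>p i l. U (Suc j) [p, i, l]) g"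
    if "j < k - 1" for j
    using U[rule_format, of "Suc j"] that left_orthogonal_iff[of "U (Suc j)" "\<rho> j"] by simp
  from nested_code_of_selections[where h = "\<lambda>j p i l. U j [p, i, l]", OF \<rho>(1) this]
  obtain e where e: "nested_code \<rho> d (k - 1) e"
    and eU: "\<And>j p i l. j < k - 1 \<Longrightarrow> p < \<rho> j \<Longrightarrow> i < d (Suc j) \<Longrightarrow> l < \<rho> (Suc j) \<Longrightarrow>
      U (Suc j) [p, i, l] = of_bool (e (Suc j) l = e j p @ [i])"
    by blast
  have "\<exists>g. slice_selection (\<rho> (M - j)) (d (Suc M - Suc j)) (\<rho> (M - Suc j)) (\<lambda>l i p. V (Suc M - Suc j) [p, i, l]) g"
    if "j < M - k" for j
    using V[rule_format, of "M - j"] that right_orthogonal_iff[of "V (M - j)" "\<rho> (M - Suc j)" _ "\<rho> (M - j)"] by simp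
  from nested_code_of_selections[where h = "\<lambda>j l i p. V (Suc M - j) [p, i, l]" and d = "\<lambda>j. d (Suc M - j)"
      and \<rho> = "\<lambda>j. \<rho> (M - j)", OF _ this] \<rho>(2)
  obtain e' where e': "nested_code (\<lambda>j. \<rho> (M - j)) (\<lambda>j. d (Suc M - j)) (M - k) e'"
    and eV: "\<And>j p i l. j < M - k \<Longrightarrow> p < \<rho> (M - j) \<Longrightarrow> i < d (Suc M - Suc j) \<Longrightarrow> l < \<rho> (M - Suc j) \<Longrightarrow>
      V (Suc M - Suc j) [l, i, p] = of_bool (e' (Suc j) l = e' j p @ [i])"
    by (simp only: diff_zero) blast
  define t where "t = (\<lambda>j l. rev (e' (M - j) l))"
  have "nested_code (\<lambda>j. \<rho> (M - j)) (\<lambda>j. d (Suc M - j)) (M - k) (\<lambda>j l. rev (t (M - j) l)) =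
      nested_code (\<lambda>j. \<rho> (M - j)) (\<lambda>j. d (Suc M - j)) (M - k) e'"
    by (auto simp: nested_code_def t_def)
  then have t: "suffix_code \<rho> d M k t"
    using e' suffix_code_iff_nested_code[OF k(2)] by simp
  have tV: "V (Suc j) [p, i, l] = of_bool (t j p = i # t (Suc j) l)"
    if "k \<le> j" "j < M" "p < \<rho> j" "i < d (Suc j)" "l < \<rho> (Suc j)" for j p i l
  proof -
    have "M - Suc j < M - k" "M - (M - Suc j) = Suc j" "M - Suc (M - Suc j) = j" "Suc (M - Suc j) = M - j"
      using that by auto
    with eV[of "M - Suc j" l i p] that
    have "V (Suc j) [p, i, l] = of_bool (e' (M - j) p = e' (M - Suc j) l @ [i])" by simp
    then show ?thesis by (simp add: t_def rev_swap)
  qed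
  show thesis
  proof (rule that[OF es e t])
    show "selection_matrix (map d [1..<M + 1]) es (code_index (e (k - 1)) (t k)) Q"
      unfolding es Q using core_matrix_selection[OF k e t eU tV] by blast
    show "\<rho> j \<le> R" if "1 < k" "j < k" for j
      using U[rule_format, of j] U[rule_format, of 1] that by (cases "j = 0") auto
    show "\<rho> j \<le> R" if "k < M" "k \<le> j" "j \<le> M" for j
      using V[rule_format, of j] V[rule_format, of "Suc k"] that by (cases "j = k") auto
  qed
qed

text \<open>Labels determine cores: the core entry at \<open>[p, i, l]\<close> tests whether the label of \<open>l\<close> extends that of
  \<open>p\<close> by \<open>i\<close>, or, on the right-hand side, whether the label of \<open>p\<close> is \<open>i\<close> followed by that of \<open>l\<close>.\<close>

lemma codes_sparse_ops:
  assumes k: "1 \<le> k" "k \<le> M"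
    and e: "nested_code \<rho> d (k - 1) e" and t: "suffix_code \<rho> d M k t"
    and R: "\<And>j. 1 < k \<Longrightarrow> j < k \<Longrightarrow> \<rho> j \<le> R" "\<And>j. k < M \<Longrightarrow> k \<le> j \<Longrightarrow> j \<le> M \<Longrightarrow> \<rho> j \<le> R"
    and ends: "\<rho> 0 = 1" "\<rho> M = 1"
  obtains Q where "([\<rho> (k - 1), d k, \<rho> k], Q) \<in> sparse_ops M d R k"
    and "selection_matrix (map d [1..<M + 1]) [\<rho> (k - 1), d k, \<rho> k] (code_index (e (k - 1)) (t k)) Q"
proof -
  \<comment> \<open>The test for membership makes the cores vanish outside their shape.\<close>
  define U :: "nat \<Rightarrow> nat list \<Rightarrow> real" where "U = (\<lambda>j is. of_bool (is \<in> multi_indices [\<rho> (j - 1), d j, \<rho> j] \<and>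
    e j (is ! 2) = e (j - 1) (is ! 0) @ [is ! 1]))"
  define V :: "nat \<Rightarrow> nat list \<Rightarrow> real" where "V = (\<lambda>j is. of_bool (is \<in> multi_indices [\<rho> (j - 1), d j, \<rho> j] \<and>
    t (j - 1) (is ! 0) = is ! 1 # t j (is ! 2)))"
  have eU: "U (Suc j) [p, i, l] = of_bool (e (Suc j) l = e j p @ [i])"
    if "p < \<rho> j" "i < d (Suc j)" "l < \<rho> (Suc j)" for j p i l
    using that by (simp add: U_def multi_indices_Cons multi_indices_Nil)
  have tV: "V (Suc j) [p, i, l] = of_bool (t j p = i # t (Suc j) l)"
    if "p < \<rho> j" "i < d (Suc j)" "l < \<rho> (Suc j)" for j p i l
    using that by (simp add: V_def multi_indices_Cons multi_indices_Nil)
  define Q where "Q = core_matrix M d k \<rho> U V"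
  have rU: "range (U j) \<subseteq> {0, 1}" and sU: "U j \<in> tensors [\<rho> (j - 1), d j, \<rho> j]"
    and rV: "range (V j) \<subseteq> {0, 1}" and sV: "V j \<in> tensors [\<rho> (j - 1), d j, \<rho> j]" for j
    by (auto simp: U_def V_def tensors_def)
  have U: "left_orthogonal [\<rho> (j - 1), d j, \<rho> j] (U j) \<and> sparse [\<rho> (j - 1), d j, \<rho> j] (\<rho> j) (U j)"
    if "j \<in> {1..<k}" for j
  proof -
    define i where "i = j - 1"
    have i: "j = Suc i" "i < k - 1" using that by (auto simp: i_def)
    obtain g where "slice_selection (\<rho> i) (d j) (\<rho> j) (\<lambda>p i' l. of_bool (e j l = e i p @ [i'])) g"
      using selection_of_nested_code[OF e i(2)] i by auto
    then have "slice_selection (\<rho> (j - 1)) (d j) (\<rho> j) (\<lambda>p i l. U j [p, i, l]) g"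
      using eU i by (auto simp: slice_selection_def)
    then show ?thesis using left_orthogonal_iff[OF rU] sparse_left by blast
  qed
  have V: "right_orthogonal [\<rho> (j - 1), d j, \<rho> j] (V j) \<and> sparse [\<rho> (j - 1), d j, \<rho> j] (\<rho> (j - 1)) (V j)"
    if "j \<in> {k<..M}" for j
  proof -
    have j: "M - j < M - k" "M - (M - j) = j" "M - Suc (M - j) = j - 1" "Suc M - Suc (M - j) = j" "Suc (j - 1) = j"
      using that by auto
    note t' = t[unfolded suffix_code_iff_nested_code[OF k(2)]]
    obtain g where "slice_selection (\<rho> j) (d j) (\<rho> (j - 1)) (\<lambda>l i p. of_bool (t (j - 1) p = i # t j l)) g"
      using selection_of_nested_code[OF t' j(1)] unfolding j rev_eq_rev_snoc_iff by auto
    then have "slice_selection (\<rho> j) (d j) (\<rho> (j - 1)) (\<lambda>l i p. V j [p, i, l]) g"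
      using tV[of _ "j - 1"] j(5) by (auto simp: slice_selection_def)
    then show ?thesis using right_orthogonal_iff[OF rV] sparse_right by blast
  qed
  have "([\<rho> (k - 1), d k, \<rho> k], Q) \<in> sparse_ops M d R k"
    unfolding sparse_ops_def Let_def mem_Collect_eq case_prod_conv
    using ends rU sU rV sV U V R Q_def
    by (intro exI[of _ \<rho>] exI[of _ U] exI[of _ V]) auto
  moreover have "selection_matrix (map d [1..<M + 1]) [\<rho> (k - 1), d k, \<rho> k] (code_index (e (k - 1)) (t k)) Q"
    unfolding Q_def using core_matrix_selection[OF k e t eU tV] by blast
  ultimately show thesis by (rule that)
qed


section \<open>The model in terms of supports\<close>

text \<open>For the forward direction the operators for \<open>k = M\<close> and \<open>k = 1\<close> suffice: the first has prefix labels of all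
  lengths below \<open>M\<close>, the second suffix labels for all starting points above \<open>0\<close>, and truncating a
  label gives a shorter label. Conversely, for each \<open>k\<close> the prefixes and suffixes that occur in the
  support are taken as labels. If the support is empty, the empty word still has to be present as a
  label, since the boundary ranks are \<open>1\<close>; that is why \<open>R\<close> must be positive when there are cores.\<close>

lemma sparse_model_iff:
  assumes "1 \<le> M"
  shows "A \<in> sparse_model M d R r \<omega> \<longleftrightarrow>
    A \<in> tensors (map d [1..<M + 1]) \<and> (\<Sum>x\<in>{x. A x \<noteq> 0}. (\<omega> x)\<^sup>2) \<le> ennreal r \<and>
    (1 < M \<longrightarrow> 1 \<le> R) \<and>
    (\<forall>j. 0 < j \<and> j < M \<longrightarrow> card (take j ` {x. A x \<noteq> 0}) \<le> R \<and> card (drop j ` {x. A x \<noteq> 0}) \<le> R)"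
    (is "_ \<longleftrightarrow> ?tensor \<and> ?weight \<and> ?pos \<and> ?cards")
proof
  let ?ds = "map d [1..<M + 1]"
  assume model: "A \<in> sparse_model M d R r \<omega>"
  have codes: "\<exists>\<rho> e t. nested_code \<rho> d (k - 1) e \<and> suffix_code \<rho> d M k t \<and>
      (\<forall>j. 1 < k \<longrightarrow> j < k \<longrightarrow> \<rho> j \<le> R) \<and> (\<forall>j. k < M \<longrightarrow> k \<le> j \<longrightarrow> j \<le> M \<longrightarrow> \<rho> j \<le> R) \<and>
      ?tensor \<and> ?weight \<and>
      {x. A x \<noteq> 0} \<subseteq> code_index (e (k - 1)) (t k) ` multi_indices [\<rho> (k - 1), d k, \<rho> k]"
    if k: "1 \<le> k" "k \<le> M" for k
  proof -
    obtain es Q where Q: "(es, Q) \<in> sparse_ops M d R k"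
      and A: "A \<in> operator_image ?ds es Q (weighted_cores ?ds es Q r \<omega>)"
      using model k unfolding sparse_model_def Let_def by fastforce
    from Q k show ?thesis
    proof (rule sparse_ops_codes)
      fix \<rho> e t
      assume es: "es = [\<rho> (k - 1), d k, \<rho> k]" and e: "nested_code \<rho> d (k - 1) e"
        and t: "suffix_code \<rho> d M k t"
        and R: "\<And>j. 1 < k \<Longrightarrow> j < k \<Longrightarrow> \<rho> j \<le> R" "\<And>j. k < M \<Longrightarrow> k \<le> j \<Longrightarrow> j \<le> M \<Longrightarrow> \<rho> j \<le> R"
        and sel: "selection_matrix ?ds es (code_index (e (k - 1)) (t k)) Q"
      note im_inj = code_index_image_inj[OF k e t]
      have "?tensor \<and> {x. A x \<noteq> 0} \<subseteq> code_index (e (k - 1)) (t k) ` multi_indices es \<and> ?weight"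
        using A unfolding operator_image_selection_iff[OF sel im_inj(2,1)[folded es]] .
      then show ?thesis
        unfolding es using e t R by (intro exI[of _ \<rho>] exI[of _ e] exI[of _ t] conjI allI impI) auto
    qed
  qed
  have card_le: "card T \<le> R" if "T \<subseteq> f ` {..<n}" "n \<le> R" for T and f :: "nat \<Rightarrow> nat list" and n
    using card_mono[OF _ that(1)] card_image_le[of "{..<n}" f] that(2) by simp
  from codes[of M] assms obtain \<rho> e t where e: "nested_code \<rho> d (M - 1) e"
    and RM: "\<forall>j. 1 < M \<longrightarrow> j < M \<longrightarrow> \<rho> j \<le> R" and tw: ?tensor ?weight
    and supM: "{x. A x \<noteq> 0} \<subseteq> code_index (e (M - 1)) (t M) ` multi_indices [\<rho> (M - 1), d M, \<rho> M]"
    by auto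
  have pos: ?pos using RM e by (auto simp: nested_code_def dest!: spec[of _ 0])
  have takes: "card (take j ` {x. A x \<noteq> 0}) \<le> R" if j: "0 < j" "j < M" for j
  proof (rule card_le)
    show "\<rho> j \<le> R" using RM j by simp
    show "take j ` {x. A x \<noteq> 0} \<subseteq> e j ` {..<\<rho> j}"
    proof
      fix y assume "y \<in> take j ` {x. A x \<noteq> 0}"
      then obtain a ys where a: "a < \<rho> (M - 1)" and y: "y = take j (e (M - 1) a @ ys)"
        using supM by (auto simp: multi_indices_Cons multi_indices_Nil code_index_def)
      have "length (e (M - 1) a) = M - 1"
        using length_multi_indices[OF nested_code_in[OF e _ a]] by (simp del: upt_Suc)
      then have "y = take j (e (M - 1) a)" using y j by simp
      then show "y \<in> e j ` {..<\<rho> j}" using nested_code_take[OF e, of j "M - 1" a] j a by simp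
    qed
  qed
  from codes[of 1] assms obtain \<rho>' e' t' where e': "nested_code \<rho>' d 0 e'" and t': "suffix_code \<rho>' d M 1 t'"
    and R1: "\<forall>j. 1 < M \<longrightarrow> 1 \<le> j \<longrightarrow> j \<le> M \<longrightarrow> \<rho>' j \<le> R"
    and sup1: "{x. A x \<noteq> 0} \<subseteq> code_index (e' 0) (t' 1) ` multi_indices [\<rho>' 0, d 1, \<rho>' 1]"
    by auto
  have drops: "card (drop j ` {x. A x \<noteq> 0}) \<le> R" if j: "0 < j" "j < M" for j
  proof (rule card_le)
    show "\<rho>' j \<le> R" using R1 j by simp
    show "drop j ` {x. A x \<noteq> 0} \<subseteq> t' j ` {..<\<rho>' j}"
    proof
      fix y assume "y \<in> drop j ` {x. A x \<noteq> 0}"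
      then obtain a i c where a: "a < \<rho>' 0" and c: "c < \<rho>' 1" and y: "y = drop j (e' 0 a @ i # t' 1 c)"
        using sup1 by (auto simp: multi_indices_Cons multi_indices_Nil code_index_def)
      have "e' 0 a = []" using e' a by (simp add: nested_code_def)
      then have "y = drop (j - 1) (t' 1 c)" using y j by (simp add: drop_Cons')
      then show "y \<in> t' j ` {..<\<rho>' j}" using suffix_code_drop[OF t', of j c] j c by simp
    qed
  qed
  show "?tensor \<and> ?weight \<and> ?pos \<and> ?cards" using tw pos takes drops by blast
next
  let ?ds = "map d [1..<M + 1]"
  assume "?tensor \<and> ?weight \<and> ?pos \<and> ?cards"
  then have tensor: ?tensor and weight: ?weight and pos: ?pos and cards: ?cards by blast+
  define Y where "Y = {x. A x \<noteq> 0}"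
  have Y: "Y \<subseteq> multi_indices ?ds" using tensor by (auto simp: Y_def tensors_def)
  then have finY: "finite Y" using finite_multi_indices finite_subset by blast
  have lenY: "length x = M" if "x \<in> Y" for x
    using Y that length_multi_indices[of x ?ds] by (auto simp del: upt_Suc)
  have entryY: "x ! j < d (Suc j)" if "x \<in> Y" "j < M" for x j
    using Y that by (force simp: multi_indices_def simp del: upt_Suc)
  show "A \<in> sparse_model M d R r \<omega>"
    unfolding sparse_model_def Let_def
  proof (intro InterI, clarsimp simp del: upt_Suc)
    fix k assume "Suc 0 \<le> k" "k \<le> M"
    then have k: "1 \<le> k" "k \<le> M" by auto
    \<comment> \<open>The empty word is put in separately because the support may be empty.\<close>
    define S where "S = (\<lambda>j. if j = 0 then {[]} else take j ` Y)"
    define T where "T = (\<lambda>j. if j = M then {[]} else drop j ` Y)"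
    obtain e where e: "nested_code (\<lambda>j. card (S j)) d (k - 1) e"
      and imS: "\<And>j. j \<le> k - 1 \<Longrightarrow> e j ` {..<card (S j)} = S j"
    proof (rule nested_code_of_sets[of S "k - 1" d])
      show "S 0 = {[]}" "finite (S j)" for j using finY by (auto simp: S_def)
      fix j x assume j: "j < k - 1" and "x \<in> S (Suc j)"
      then obtain s where s: "s \<in> Y" "x = take (Suc j) s" by (auto simp: S_def)
      then have "x = take j s @ [s ! j]" "s ! j < d (Suc j)"
        using lenY entryY j k by (auto simp: take_Suc_conv_app_nth)
      moreover have "take j s \<in> S j" using s by (auto simp: S_def)
      ultimately show "\<exists>y\<in>S j. \<exists>i<d (Suc j). x = y @ [i]" by blast
    qed auto
    obtain e' where e': "nested_code (\<lambda>j. card (rev ` T (M - j))) (\<lambda>j. d (Suc M - j)) (M - k) e'"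
      and imT: "\<And>j. j \<le> M - k \<Longrightarrow> e' j ` {..<card (rev ` T (M - j))} = rev ` T (M - j)"
    proof (rule nested_code_of_sets[of "\<lambda>j. rev ` T (M - j)" "M - k" "\<lambda>j. d (Suc M - j)"])
      show "rev ` T (M - 0) = {[]}" "finite (rev ` T (M - j))" for j using finY by (auto simp: T_def)
      fix j x assume j: "j < M - k" and "x \<in> rev ` T (M - Suc j)"
      then obtain s where s: "s \<in> Y" "x = rev (drop (M - Suc j) s)" by (auto simp: T_def split: if_splits)
      have "drop (M - Suc j) s = s ! (M - Suc j) # drop (M - j) s"
        using Cons_nth_drop_Suc[of "M - Suc j" s] lenY[OF s(1)] j k by (simp add: Suc_diff_Suc)
      then have "x = rev (drop (M - j) s) @ [s ! (M - Suc j)]" using s by simp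
      moreover have "s ! (M - Suc j) < d (Suc M - Suc j)"
        using entryY[OF s(1), of "M - Suc j"] j by (simp add: Suc_diff_Suc)
      moreover have "rev (drop (M - j) s) \<in> rev ` T (M - j)" using s lenY by (auto simp: T_def)
      ultimately show "\<exists>y\<in>rev ` T (M - j). \<exists>i<d (Suc M - Suc j). x = y @ [i]" by blast
    qed auto
    \<comment> \<open>The prefix labels use the ranks below \<open>k\<close> and the suffix labels those from \<open>k\<close> on.\<close>
    define \<rho> where "\<rho> = (\<lambda>j. if j < k then card (S j) else card (T j))"
    define t where "t = (\<lambda>j l. rev (e' (M - j) l))"
    have \<rho>_low: "\<rho> j = card (S j)" if "j < k" for j using that by (simp add: \<rho>_def)
    have \<rho>_high: "\<rho> j = card (T j)" if "k \<le> j" for j using that by (simp add: \<rho>_def)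
    have e\<rho>: "nested_code \<rho> d (k - 1) e"
      using e k by (auto simp: nested_code_def \<rho>_low)
    have "nested_code (\<lambda>j. \<rho> (M - j)) (\<lambda>j. d (Suc M - j)) (M - k) (\<lambda>j l. rev (t (M - j) l))"
      using e' k by (auto simp: nested_code_def \<rho>_high t_def card_image)
    then have t\<rho>: "suffix_code \<rho> d M k t"
      using suffix_code_iff_nested_code[OF k(2)] by simp
    have low: "\<rho> j \<le> R" if "1 < k" "j < k" for j
      using that k pos cards by (auto simp: \<rho>_low S_def Y_def)
    have high: "\<rho> j \<le> R" if "k < M" "k \<le> j" "j \<le> M" for j
      using that k pos cards by (auto simp: \<rho>_high T_def Y_def)
    have ends: "\<rho> 0 = 1" "\<rho> M = 1"
      using k by (auto simp: \<rho>_def S_def T_def)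
    obtain Q where Q: "([\<rho> (k - 1), d k, \<rho> k], Q) \<in> sparse_ops M d R k"
      and sel: "selection_matrix ?ds [\<rho> (k - 1), d k, \<rho> k] (code_index (e (k - 1)) (t k)) Q"
      using codes_sparse_ops[OF k e\<rho> t\<rho> low high ends] by blast
    have "Y \<subseteq> code_index (e (k - 1)) (t k) ` multi_indices [\<rho> (k - 1), d k, \<rho> k]"
    proof
      fix x assume x: "x \<in> Y"
      have "take (k - 1) x \<in> S (k - 1)" using x by (auto simp: S_def)
      then obtain a where a: "a < \<rho> (k - 1)" "take (k - 1) x = e (k - 1) a"
        using imS[of "k - 1"] \<rho>_low[of "k - 1"] k by auto
      have "rev (drop k x) \<in> rev ` T k" using x lenY by (auto simp: T_def)
      moreover have "e' (M - k) ` {..<\<rho> k} = rev ` T k"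
        using imT[of "M - k"] \<rho>_high[of k] k by (simp add: card_image)
      ultimately obtain c where "c < \<rho> k" "rev (drop k x) = e' (M - k) c"
        by (metis imageE lessThan_iff)
      then have c: "c < \<rho> k" "drop k x = t k c" by (auto simp: t_def simp flip: rev_swap)
      have "x = take (k - 1) x @ x ! (k - 1) # drop k x"
        using id_take_nth_drop[of "k - 1" x] lenY[OF x] k by simp
      then have "x = code_index (e (k - 1)) (t k) [a, x ! (k - 1), c]"
        using a c by (simp add: code_index_def)
      moreover have "[a, x ! (k - 1), c] \<in> multi_indices [\<rho> (k - 1), d k, \<rho> k]"
        using a c entryY[OF x, of "k - 1"] k by (simp add: multi_indices_Cons multi_indices_Nil)
      ultimately show "x \<in> code_index (e (k - 1)) (t k) ` multi_indices [\<rho> (k - 1), d k, \<rho> k]" by blast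
    qed
    then have "A \<in> operator_image ?ds [\<rho> (k - 1), d k, \<rho> k] Q (weighted_cores ?ds [\<rho> (k - 1), d k, \<rho> k] Q r \<omega>)"
      using tensor weight code_index_image_inj[OF k e\<rho> t\<rho>]
      by (subst operator_image_selection_iff[OF sel]) (auto simp: Y_def)
    with Q show "\<exists>x\<in>sparse_ops M d R k. A \<in> (case x of (es, Q) \<Rightarrow>
        operator_image (map d [Suc 0..<Suc M]) es Q (weighted_cores (map d [Suc 0..<Suc M]) es Q r \<omega>))"
      by (intro bexI[OF _ Q]) simp
  qed
qed

theorem proposition42:
  fixes M R :: nat and d :: "nat \<Rightarrow> nat" and r :: real and \<omega> :: "nat list \<Rightarrow> ennreal"
  assumes "M \<ge> 1" and "r \<ge> 0" and "\<omega> \<in> tensors (map d [1..<M + 1])"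
  shows "{A - B | A B. A \<in> sparse_model M d R r \<omega> \<and> B \<in> sparse_model M d R r \<omega>}
    \<subseteq> sparse_model M d (2 * R) (2 * r) \<omega>"
proof
  fix D assume "D \<in> {A - B | A B. A \<in> sparse_model M d R r \<omega> \<and> B \<in> sparse_model M d R r \<omega>}"
  then obtain A B where D: "D = A - B" and A: "A \<in> sparse_model M d R r \<omega>"
    and B: "B \<in> sparse_model M d R r \<omega>" by blast
  let ?supp = "\<lambda>T :: nat list \<Rightarrow> real. {x. T x \<noteq> 0}"
  note A' = A[unfolded sparse_model_iff[OF assms(1)]] and B' = B[unfolded sparse_model_iff[OF assms(1)]]
  have tensor: "D \<in> tensors (map d [1..<M + 1])"
    using A' B' by (simp add: D tensors_def del: upt_Suc)
  have fin: "finite (?supp T)" if "T \<in> tensors (map d [1..<M + 1])" for T :: "nat list \<Rightarrow> real"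
    by (rule finite_subset[OF _ finite_multi_indices]) (use that in \<open>auto simp: tensors_def simp del: upt_Suc\<close>)
  have finA: "finite (?supp A)" and finB: "finite (?supp B)" using A' B' fin by blast+
  have supp: "?supp D \<subseteq> ?supp A \<union> ?supp B" by (auto simp: D)
  have "(\<Sum>x\<in>?supp D. (\<omega> x)\<^sup>2) \<le> (\<Sum>x\<in>?supp A \<union> ?supp B. (\<omega> x)\<^sup>2)"
    using finA finB supp by (intro sum_mono2) auto
  also have "\<dots> \<le> (\<Sum>x\<in>?supp A. (\<omega> x)\<^sup>2) + (\<Sum>x\<in>?supp B. (\<omega> x)\<^sup>2)"
    by (subst sum.union_inter[OF finA finB, symmetric]) simp
  also have "\<dots> \<le> ennreal r + ennreal r" using A' B' by (intro add_mono) auto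
  also have "\<dots> = ennreal (2 * r)" using assms(2) by (simp flip: ennreal_plus)
  finally have weight: "(\<Sum>x\<in>?supp D. (\<omega> x)\<^sup>2) \<le> ennreal (2 * r)" .
  have image_le: "card (f ` ?supp D) \<le> 2 * R"
    if "card (f ` ?supp A) \<le> R" "card (f ` ?supp B) \<le> R" for f :: "nat list \<Rightarrow> nat list"
  proof -
    have "card (f ` ?supp D) \<le> card (f ` ?supp A \<union> f ` ?supp B)"
      using finA finB supp by (intro card_mono) auto
    also have "\<dots> \<le> card (f ` ?supp A) + card (f ` ?supp B)" by (rule card_Un_le)
    finally show ?thesis using that by simp
  qed
  show "D \<in> sparse_model M d (2 * R) (2 * r) \<omega>"
    unfolding sparse_model_iff[OF assms(1)]
    using A' B' by (intro conjI tensor weight) (auto intro: image_le)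
qed

end
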